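(* Let $A,B,C$ be $2\times2$ real upper-triangular (floating-point) matrices with $A$ nonsingular. Suppose that $\overline A'$, $\overline B'$, $\overline C'$, $\overline H$, $\overline K$, $\overline P$, $\overline Q$, $\overline U$, and $\overline V$ are computed by Algorithm RSVD22 (given in the context) in floating-point arithmetic with unit roundoff $\boldsymbol\epsilon$, where the matrix $M=C\,\mathrm{adj}(A)B$ is computed as the upper-triangular matrix $\overline M$ with $$\overline m_{11}=\mathrm{fl}(\mathrm{fl}(c_{11}a_{22})b_{11}),\qquad \overline m_{22}=\mathrm{fl}(c_{22}\,\mathrm{fl}(a_{11}b_{22})),$$ $$\overline m_{12}=\mathrm{fl}\bigl(\mathrm{fl}(\mathrm{fl}(\mathrm{fl}(c_{11}a_{22})b_{12})+\mathrm{fl}(c_{12}\,\mathrm{fl}(a_{11}b_{22})))-\mathrm{fl}(\mathrm{fl}(c_{11}a_{12})b_{22})\bigr).$$ Furthermore, define $\overline H'$ and $\overline K'$ as $\mathrm{fl}(\overline Q^T\overline H)$ and $\mathrm{fl}(\overline K\,\overline P)$, respectively, with their $(1,2)$ entries set to zero. Then, up to higher-order terms in $\boldsymbol\epsilon$, the following assertions are true. 1. The matrices $\overline A'$, $\overline B'$, and $\overline C'$ are lower triangular. 2. The product $\overline V^T\overline M\,\overline U$ is within $132\boldsymbol\epsilon\|\overline M\|$ of being diagonal. 3. The (corresponding) rows of $\overline C'$ and $\mathrm{adj}(\overline H')$ are within $86\boldsymbol\epsilon\|C\|$ and $93.5\boldsymbol\epsilon\|A\|\|B\|$, respectively, of being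 parallel. Likewise, the (corresponding) columns of $\mathrm{adj}(\overline K')$ and $\overline B'$ are within $93.5\boldsymbol\epsilon\|A\|\|C\|$ and $86\boldsymbol\epsilon\|B\|$, respectively, of being parallel. 4. The matrices $\overline B'$, $\overline C'$, $\overline H'$, and $\overline K'$ are computed stably in the following sense. There exist $\delta B$, $\delta C$, $\delta H$, $\delta K$, and orthonormal matrices $\mathcal P,\mathcal Q,U,V$, such that $U^T\overline MV$ is an exact (unnormalized) SVD of $\overline M$ with the roles of $U$ and $V$ as in the algorithm (that is, $V^T\overline MU$ is diagonal), and $$\overline B'=\mathcal P^T(B+\delta B)U,\qquad \overline H'=\mathcal Q^T(\mathrm{adj}(A)B+\delta H)U,$$ $$\overline C'=V^T(C+\delta C)\mathcal Q,\qquad \overline K'=V^T(C\,\mathrm{adj}(A)+\delta K)\mathcal P,$$ where $\|\delta B\|\le493\boldsymbol\epsilon\|B\|$, $\|\delta C\|\le493\boldsymbol\epsilon\|C\|$, $\|\delta H\|\le486\boldsymbol\epsilon\|A\|\|B\|$, and $\|\delta K\|\le486\boldsymbol\epsilon\|A\|\|C\|$.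
   Context: Notation: $\|\cdot\|$ is the spectral norm; $|X|$ is the entrywise absolute value; $\mathrm{adj}$ is the adjugate, so $\mathrm{adj}(A)=\begin{bmatrix}a_{22}&-a_{12}\\0&a_{11}\end{bmatrix}$ for upper-triangular $A$; $J=\begin{bmatrix}0&1\\-1&0\end{bmatrix}$; orthonormal matrices are square real orthogonal matrices; lowercase letters denote entries. An unnormalized SVD $V^TMU=\Sigma$ has $U,V$ orthogonal and $\Sigma$ real diagonal, not necessarily with nonnegative or sorted entries. Rows (or columns) of two matrices are within $\alpha$ and $\beta$ of being parallel if the two matrices can be perturbed by matrices of norm at most $\alpha$ and $\beta$, respectively, such that the corresponding rows (or columns) become parallel. Floating-point model: for floating-point numbers $a,b$ and $\circ\in\{+,-,\cdot,/\}$, $\mathrm{fl}(a\circ b)=(a\circ b)(1+\epsilon)$ with $|\epsilon|\le\boldsymbol\epsilon$. Taking absolute values and multiplying by $0$ or $\pm1$ is exact. Overflow, underflow, and higher-order terms in $\boldsymbol\epsilon$ are ignored. Overlined quantities are the computed versions of quantities. Routines used (LAPACK): (i) xLASV2 computes an unnormalized SVD of a $2\times2$ upper-triangular matrix $\overline M$: the computed $\overline U,\overline V$ satisfy $\overline U=U+\delta U$, $\overline V=V+\delta V$, where $V^T\overline MU$ is an exact (unnormalized) SVD of $\overline M$, and each entry of $\delta U,\delta V$ is a relative perturbation of at most $46.5\boldsymbol\epsilon$ of the corresponding entry of $U,V$. (ii) xLARTG computes, from $f,g$, the rotation parameters $f/\sqrt{f^2+g^2}$ and $g/\sqrt{f^2+g^2}$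 with relative errors at most $6\boldsymbol\epsilon$ (so the computed rotation has an error of norm less than $9\boldsymbol\epsilon$). (iii) For $2\times2$ matrices, $\|\mathrm{fl}(XY)-XY\|\le4\boldsymbol\epsilon\|X\|\|Y\|$. Algorithm RSVD22. Input: $2\times2$ upper-triangular $A,B,C$ with $A$ nonsingular. (1) If $c_{11}=0$ and $b_{22}=0$: compute rotations $V$ with $(V^TC)_{22}=0$ and $U$ with $(BU)_{11}=0$, let $P=Q=J$, $A'=P^TAQ$, $B'=P^TBU$, $C'=V^TCQ$, set $b_{21}'=c_{21}'=0$, and stop. (2) Otherwise compute an unnormalized SVD $V^TMU=\Sigma$ of $M=C\,\mathrm{adj}(A)B$ with xLASV2. Let $c_{\max}=\max\{|u_{11}|,|v_{11}|\}$, $s_{\max}=\max\{|u_{12}|,|v_{12}|\}$. If $c_{11},c_{22},b_{11},b_{22}$ are all nonzero and $c_{\max}<s_{\max}$, replace $U$ by $UJ$ and $V$ by $VJ$. (3) Let $G=V^TC$ (optionally set $g_{22}=0$ if $c_{11}=0$), $L=BU$ (optionally set $l_{12}=0$ if $b_{22}=0$), $\widehat G=|V|^T|C|$, $H=\mathrm{adj}(A)L$, $\widehat H=|\mathrm{adj}(A)||B||U|$, $K=G\,\mathrm{adj}(A)$, $\widehat K=|V|^T|C||\mathrm{adj}(A)|$, $\widehat L=|B||U|$. (4) Let $\eta_g=(\widehat g_{11}+\widehat g_{12})/(|g_{11}|+|g_{12}|)$, $\eta_h=(\widehat h_{12}+\widehat h_{22})/(|h_{12}|+|h_{22}|)$,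 $\eta_k=(\widehat k_{11}+\widehat k_{12})/(|k_{11}|+|k_{12}|)$, $\eta_l=(\widehat l_{12}+\widehat l_{22})/(|l_{12}|+|l_{22}|)$ (each $\infty$ if its denominator is $0$). (5) If $|h_{12}|+|h_{22}|=0$ or ($|g_{11}|+|g_{12}|\ne0$ and $\eta_g\le\eta_h$), use xLARTG to compute a rotation $Q$ such that $GQ$ is lower triangular; otherwise use xLARTG to compute $Q$ such that $Q^TH$ is lower triangular. (6) If $|k_{11}|+|k_{12}|=0$ or ($|l_{12}|+|l_{22}|\ne0$ and $\eta_l\le\eta_k$), use xLARTG to compute a rotation $P$ such that $P^TL$ is lower triangular; otherwise use xLARTG to compute $P$ such that $KP$ is lower triangular. (7) Let $A'=P^TAQ$, $B'=P^TL$, $C'=GQ$, and set $a_{12}'=b_{12}'=c_{12}'=0$. When the algorithm stops in step (1), $H$ and $K$ are understood as $\mathrm{adj}(A)BU$ and $V^TC\,\mathrm{adj}(A)$.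
   Formalization: If an optional assignment g22=0 or l12=0 is enabled, xLASV2 is also assumed to return Σ with |σ11| ≥ |σ22|; otherwise the claim fails (A=B=I, C=diag(0,1), U=V=I gives C'=0). *)

theory Defs
  imports "HOL-Analysis.Analysis"
begin

section \<open>Real \<open>2 \<times> 2\<close> matrices\<close>

type_synonym rmat2 = "real^2^2"

definition mat2 :: "real \<Rightarrow> real \<Rightarrow> real \<Rightarrow> real \<Rightarrow> rmat2" where
  "mat2 a b c d = vector [vector [a, b], vector [c, d]]"

definition adj2 :: "rmat2 \<Rightarrow> rmat2" where
  "adj2 X = mat2 (X$2$2) (- (X$1$2)) (- (X$2$1)) (X$1$1)"

definition J2 :: rmat2 where
  "J2 = mat2 0 1 (- 1) 0"

definition abs_mat :: "rmat2 \<Rightarrow> rmat2" where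
  "abs_mat X = (\<chi> i j. \<bar>X$i$j\<bar>)"

definition zero_entry :: "2 \<Rightarrow> 2 \<Rightarrow> rmat2 \<Rightarrow> rmat2" where
  "zero_entry r s X = (\<chi> i j. if i = r \<and> j = s then 0 else X$i$j)"

definition upper_tri :: "rmat2 \<Rightarrow> bool" where
  "upper_tri X \<longleftrightarrow> X$2$1 = 0"

definition lower_tri :: "rmat2 \<Rightarrow> bool" where
  "lower_tri X \<longleftrightarrow> X$1$2 = 0"

definition diagonal2 :: "rmat2 \<Rightarrow> bool" where
  "diagonal2 X \<longleftrightarrow> X$1$2 = 0 \<and> X$2$1 = 0"

text \<open>The library's \<^const>\<open>norm\<close> on matrices is the Frobenius norm; the spectral norm is the
  operator norm with respect to the Euclidean norm.\<close>

definition spec_norm :: "rmat2 \<Rightarrow> real" where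
  "spec_norm X = onorm (\<lambda>v. X *v v)"

definition within_of_diagonal :: "real \<Rightarrow> rmat2 \<Rightarrow> bool" where
  "within_of_diagonal \<alpha> X \<longleftrightarrow> (\<exists>E. spec_norm E \<le> \<alpha> \<and> diagonal2 (X + E))"

text \<open>Two vectors \<open>x\<close> and \<open>y\<close> are parallel iff \<open>0\<close>, \<open>x\<close>, \<open>y\<close> are collinear; in particular the zero
  vector is parallel to every vector.\<close>

definition rows_within_of_parallel :: "real \<Rightarrow> real \<Rightarrow> rmat2 \<Rightarrow> rmat2 \<Rightarrow> bool" where
  "rows_within_of_parallel \<alpha> \<beta> X Y \<longleftrightarrow>
     (\<exists>E F. spec_norm E \<le> \<alpha> \<and> spec_norm F \<le> \<beta> \<and>
        (\<forall>i. collinear {0, row i (X + E), row i (Y + F)}))"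

definition columns_within_of_parallel :: "real \<Rightarrow> real \<Rightarrow> rmat2 \<Rightarrow> rmat2 \<Rightarrow> bool" where
  "columns_within_of_parallel \<alpha> \<beta> X Y \<longleftrightarrow>
     (\<exists>E F. spec_norm E \<le> \<alpha> \<and> spec_norm F \<le> \<beta> \<and>
        (\<forall>j. collinear {0, column j (X + E), column j (Y + F)}))"

section \<open>Floating-point arithmetic\<close>

text \<open>\<open>xlasv2 M\<close> returns the pair \<open>(U, V)\<close>; \<open>xlartg f g\<close> returns the pair \<open>(c, s)\<close>.\<close>

record fp_env =
  fl_nums :: "real set"
  fl_add :: "real \<Rightarrow> real \<Rightarrow> real"
  fl_sub :: "real \<Rightarrow> real \<Rightarrow> real"
  fl_mul :: "real \<Rightarrow> real \<Rightarrow> real"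
  fl_div :: "real \<Rightarrow> real \<Rightarrow> real"
  xlasv2 :: "rmat2 \<Rightarrow> rmat2 \<times> rmat2"
  xlartg :: "real \<Rightarrow> real \<Rightarrow> real \<times> real"

definition rel_approx :: "real \<Rightarrow> real \<Rightarrow> real \<Rightarrow> bool" where
  "rel_approx \<delta> x y \<longleftrightarrow> (\<exists>e. \<bar>e\<bar> \<le> \<delta> \<and> y = x * (1 + e))"

text \<open>Closure of the set of floating-point numbers under the operations expresses that overflow and
  underflow are ignored. That multiplication by \<open>0\<close> is exact, and that the absolute value of a
  floating-point number is a floating-point number, follows.\<close>

definition fl_ops_model :: "real \<Rightarrow> fp_env \<Rightarrow> bool" where
  "fl_ops_model \<epsilon> fp \<longleftrightarrow>
     {0, 1, - 1} \<subseteq> fl_nums fp \<and>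
     (\<forall>a \<in> fl_nums fp. \<forall>b \<in> fl_nums fp.
        fl_add fp a b \<in> fl_nums fp \<and> rel_approx \<epsilon> (a + b) (fl_add fp a b) \<and>
        fl_sub fp a b \<in> fl_nums fp \<and> rel_approx \<epsilon> (a - b) (fl_sub fp a b) \<and>
        fl_mul fp a b \<in> fl_nums fp \<and> rel_approx \<epsilon> (a * b) (fl_mul fp a b) \<and>
        (b \<noteq> 0 \<longrightarrow> fl_div fp a b \<in> fl_nums fp \<and> rel_approx \<epsilon> (a / b) (fl_div fp a b))) \<and>
     (\<forall>a \<in> fl_nums fp.
        fl_mul fp 1 a = a \<and> fl_mul fp a 1 = a \<and>
        fl_mul fp (- 1) a = - a \<and> fl_mul fp a (- 1) = - a)"

definition fl_mat :: "fp_env \<Rightarrow> rmat2 \<Rightarrow> bool" where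
  "fl_mat fp X \<longleftrightarrow> (\<forall>i j. X$i$j \<in> fl_nums fp)"

definition unnormalized_svd :: "rmat2 \<Rightarrow> rmat2 \<Rightarrow> rmat2 \<Rightarrow> bool" where
  "unnormalized_svd M U V \<longleftrightarrow>
     orthogonal_matrix U \<and> orthogonal_matrix V \<and> diagonal2 (transpose V ** M ** U)"

text \<open>The flag \<open>ordered\<close> adds the documented property of xLASV2 that the first diagonal entry of
  \<open>\<Sigma>\<close> is the one of largest absolute value. It is what justifies the optional assignments
  \<open>g\<^sub>2\<^sub>2 = 0\<close> and \<open>l\<^sub>1\<^sub>2 = 0\<close> of the algorithm, and is not required without them: if \<open>c\<^sub>1\<^sub>1 = 0\<close>, then the
  first column of \<open>M\<close> is zero, and \<open>(V\<^sup>T C)\<^sub>2\<^sub>2\<close> vanishes if \<open>\<Sigma> = diag(\<sigma>, 0)\<close> but not if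
  \<open>\<Sigma> = diag(0, \<sigma>)\<close> with \<open>\<sigma> \<noteq> 0\<close>; similarly for \<open>b\<^sub>2\<^sub>2 = 0\<close>.\<close>

definition xlasv2_model :: "real \<Rightarrow> bool \<Rightarrow> fp_env \<Rightarrow> bool" where
  "xlasv2_model \<epsilon> ordered fp \<longleftrightarrow>
     (\<forall>M U\<^sub>c V\<^sub>c. fl_mat fp M \<and> upper_tri M \<and> xlasv2 fp M = (U\<^sub>c, V\<^sub>c) \<longrightarrow>
        fl_mat fp U\<^sub>c \<and> fl_mat fp V\<^sub>c \<and>
        (\<exists>U V. unnormalized_svd M U V \<and>
           (ordered \<longrightarrow>
              \<bar>(transpose V ** M ** U)$1$1\<bar> \<ge> \<bar>(transpose V ** M ** U)$2$2\<bar>) \<and>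
           (\<forall>i j. rel_approx (46.5 * \<epsilon>) (U$i$j) (U\<^sub>c$i$j) \<and>
                  rel_approx (46.5 * \<epsilon>) (V$i$j) (V\<^sub>c$i$j))))"

text \<open>For \<open>f = g = 0\<close>, where the quotients are undefined, LAPACK returns the identity rotation.\<close>

definition xlartg_model :: "real \<Rightarrow> fp_env \<Rightarrow> bool" where
  "xlartg_model \<epsilon> fp \<longleftrightarrow>
     (\<forall>f \<in> fl_nums fp. \<forall>g \<in> fl_nums fp. \<forall>c s. xlartg fp f g = (c, s) \<longrightarrow>
        c \<in> fl_nums fp \<and> s \<in> fl_nums fp \<and>
        (if f = 0 \<and> g = 0 then c = 1 \<and> s = 0
         else rel_approx (6 * \<epsilon>) (f / sqrt (f\<^sup>2 + g\<^sup>2)) c \<and>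
              rel_approx (6 * \<epsilon>) (g / sqrt (f\<^sup>2 + g\<^sup>2)) s))"

definition fl_matmul :: "fp_env \<Rightarrow> rmat2 \<Rightarrow> rmat2 \<Rightarrow> rmat2" where
  "fl_matmul fp X Y =
     (\<chi> i j. fl_add fp (fl_mul fp (X$i$1) (Y$1$j)) (fl_mul fp (X$i$2) (Y$2$j)))"

section \<open>Algorithm RSVD22 in floating-point arithmetic\<close>

definition computed_M :: "fp_env \<Rightarrow> rmat2 \<Rightarrow> rmat2 \<Rightarrow> rmat2 \<Rightarrow> rmat2" where
  "computed_M fp A B C = mat2
     (fl_mul fp (fl_mul fp (C$1$1) (A$2$2)) (B$1$1))
     (fl_sub fp
        (fl_add fp (fl_mul fp (fl_mul fp (C$1$1) (A$2$2)) (B$1$2))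
                   (fl_mul fp (C$1$2) (fl_mul fp (A$1$1) (B$2$2))))
        (fl_mul fp (fl_mul fp (C$1$1) (A$1$2)) (B$2$2)))
     0
     (fl_mul fp (C$2$2) (fl_mul fp (A$1$1) (B$2$2)))"

text \<open>\<open>rot_to_first fp x y\<close> is the computed rotation \<open>R\<close> such that \<open>(x, y) R\<close> has second component
  zero, and \<open>rot_to_second fp x y\<close> is the one such that it has first component zero. Transposed, the
  same holds for the column \<open>R\<^sup>T (x, y)\<^sup>T\<close>.\<close>

definition rot_to_first :: "fp_env \<Rightarrow> real \<Rightarrow> real \<Rightarrow> rmat2" where
  "rot_to_first fp x y = (case xlartg fp x y of (c, s) \<Rightarrow> mat2 c (- s) s c)"

definition rot_to_second :: "fp_env \<Rightarrow> real \<Rightarrow> real \<Rightarrow> rmat2" where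
  "rot_to_second fp x y = (case xlartg fp y x of (c, s) \<Rightarrow> mat2 c s (- s) c)"

definition fl_eta :: "fp_env \<Rightarrow> real \<Rightarrow> real \<Rightarrow> real \<Rightarrow> real \<Rightarrow> ereal" where
  "fl_eta fp xh yh x y =
     (let d = fl_add fp \<bar>x\<bar> \<bar>y\<bar>
      in if d = 0 then \<infinity> else ereal (fl_div fp (fl_add fp xh yh) d))"

text \<open>\<open>res_A\<close>, \<open>res_B\<close>, \<open>res_C\<close> are the transformed matrices \<open>A'\<close>, \<open>B'\<close>, \<open>C'\<close>.\<close>

record rsvd22_result =
  res_A :: rmat2
  res_B :: rmat2
  res_C :: rmat2
  res_H :: rmat2
  res_K :: rmat2
  res_P :: rmat2
  res_Q :: rmat2
  res_U :: rmat2
  res_V :: rmat2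

text \<open>The case \<open>c\<^sub>1\<^sub>1 = b\<^sub>2\<^sub>2 = 0\<close>. A multiplication by \<open>J\<close> is a swap of rows or columns with a change of
  sign; no rounding takes place.\<close>

definition rsvd22_degenerate :: "fp_env \<Rightarrow> rmat2 \<Rightarrow> rmat2 \<Rightarrow> rmat2 \<Rightarrow> rsvd22_result" where
  "rsvd22_degenerate fp A B C =
     (let V = rot_to_first fp (C$1$2) (C$2$2);
          U = rot_to_second fp (B$1$1) (B$1$2);
          G = fl_matmul fp (transpose V) C;
          L = fl_matmul fp B U
      in \<lparr> res_A = transpose J2 ** A ** J2,
           res_B = zero_entry 2 1 (transpose J2 ** L),
           res_C = zero_entry 2 1 (G ** J2),
           res_H = fl_matmul fp (adj2 A) L,
           res_K = fl_matmul fp G (adj2 A),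
           res_P = J2, res_Q = J2, res_U = U, res_V = V \<rparr>)"

definition computed_UV :: "fp_env \<Rightarrow> rmat2 \<Rightarrow> rmat2 \<Rightarrow> rmat2 \<Rightarrow> rmat2 \<times> rmat2" where
  "computed_UV fp A B C =
     (let (U, V) = xlasv2 fp (computed_M fp A B C);
          cmax = max \<bar>U$1$1\<bar> \<bar>V$1$1\<bar>;
          smax = max \<bar>U$1$2\<bar> \<bar>V$1$2\<bar>
      in if C$1$1 \<noteq> 0 \<and> C$2$2 \<noteq> 0 \<and> B$1$1 \<noteq> 0 \<and> B$2$2 \<noteq> 0 \<and> cmax < smax
         then (U ** J2, V ** J2) else (U, V))"

text \<open>The flags \<open>zg\<close> and \<open>zl\<close> tell whether the optional assignments \<open>g\<^sub>2\<^sub>2 = 0\<close> and \<open>l\<^sub>1\<^sub>2 = 0\<close> are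
  part of the algorithm.\<close>

definition rsvd22_generic ::
  "fp_env \<Rightarrow> bool \<Rightarrow> bool \<Rightarrow> rmat2 \<Rightarrow> rmat2 \<Rightarrow> rmat2 \<Rightarrow> rsvd22_result" where
  "rsvd22_generic fp zg zl A B C =
     (let (U, V) = computed_UV fp A B C;
          G0 = fl_matmul fp (transpose V) C;
          G = (if zg \<and> C$1$1 = 0 then zero_entry 2 2 G0 else G0);
          L0 = fl_matmul fp B U;
          L = (if zl \<and> B$2$2 = 0 then zero_entry 1 2 L0 else L0);
          Gh = fl_matmul fp (transpose (abs_mat V)) (abs_mat C);
          Lh = fl_matmul fp (abs_mat B) (abs_mat U);
          H = fl_matmul fp (adj2 A) L;
          Hh = fl_matmul fp (abs_mat (adj2 A)) Lh;
          K = fl_matmul fp G (adj2 A);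
          Kh = fl_matmul fp Gh (abs_mat (adj2 A));
          eta_g = fl_eta fp (Gh$1$1) (Gh$1$2) (G$1$1) (G$1$2);
          eta_h = fl_eta fp (Hh$1$2) (Hh$2$2) (H$1$2) (H$2$2);
          eta_k = fl_eta fp (Kh$1$1) (Kh$1$2) (K$1$1) (K$1$2);
          eta_l = fl_eta fp (Lh$1$2) (Lh$2$2) (L$1$2) (L$2$2);
          Q = (if fl_add fp \<bar>H$1$2\<bar> \<bar>H$2$2\<bar> = 0 \<or>
                  (fl_add fp \<bar>G$1$1\<bar> \<bar>G$1$2\<bar> \<noteq> 0 \<and> eta_g \<le> eta_h)
               then rot_to_first fp (G$1$1) (G$1$2)
               else rot_to_second fp (H$1$2) (H$2$2));
          P = (if fl_add fp \<bar>K$1$1\<bar> \<bar>K$1$2\<bar> = 0 \<or>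
                  (fl_add fp \<bar>L$1$2\<bar> \<bar>L$2$2\<bar> \<noteq> 0 \<and> eta_l \<le> eta_k)
               then rot_to_second fp (L$1$2) (L$2$2)
               else rot_to_first fp (K$1$1) (K$1$2))
      in \<lparr> res_A = zero_entry 1 2 (fl_matmul fp (fl_matmul fp (transpose P) A) Q),
           res_B = zero_entry 1 2 (fl_matmul fp (transpose P) L),
           res_C = zero_entry 1 2 (fl_matmul fp G Q),
           res_H = H, res_K = K, res_P = P, res_Q = Q, res_U = U, res_V = V \<rparr>)"

definition rsvd22 ::
  "fp_env \<Rightarrow> bool \<Rightarrow> bool \<Rightarrow> rmat2 \<Rightarrow> rmat2 \<Rightarrow> rmat2 \<Rightarrow> rsvd22_result" where
  "rsvd22 fp zg zl A B C =
     (if C$1$1 = 0 \<and> B$2$2 = 0 then rsvd22_degenerate fp A B C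
      else rsvd22_generic fp zg zl A B C)"

end

theory Submission
  imports Defs
begin

text \<open>Write \<open>G\<^sub>0 = V\<^sup>T C\<close> and \<open>H\<^sub>0 = adj(A) B U\<close> for the exact \<open>U\<close>, \<open>V\<close>. Rounding in the computation of
  \<open>M\<close> can be moved into either of the factorizations \<open>C \<cdot> (adj(A) B)\<close> and \<open>(C adj(A)) \<cdot> B\<close>, so the
  computed \<open>G\<close> and \<open>H\<close> are entrywise close to matrices whose product is exactly diagonal; likewise for
  \<open>K\<close> and \<open>L\<close>. Hence, up to rounding, the second row of \<open>G\<close> is orthogonal to the first column of \<open>H\<close>,
  which is the parallelism of the second rows of \<open>C'\<close> and \<open>adj(H')\<close>; the first rows are parallel
  because of the entries that are set to zero. The rotation annihilates one of these two entries, and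
  the other one is small because the ratios \<open>\<eta>\<close> select the factor with the smaller relative error.

  No term of order \<open>\<epsilon>\<^sup>2\<close> is needed: the first-order constants obtained here are smaller than the claimed
  ones, and the difference absorbs the higher-order terms for \<open>\<epsilon> \<le> 1 / 10^6\<close>.\<close>

section \<open>The spectral norm of \<open>2 \<times> 2\<close> matrices\<close>

text \<open>Two comparisons of the computed \<open>G\<close> and \<open>H\<close> are kept apart
  throughout. Comparison with V^T C and adj(A) B U gives the backward errors, but the product of
  these two matrices need not be diagonal, since the SVD belongs to the rounded \<open>M\<close>.
  Comparison with the perturbed factors, whose product is V^T M U, gives the orthogonality. Both
  errors are measured against one dominating matrix, |V|^T |C| or |adj(A)| |B| |U|, because
  cancellation can make the exact entries arbitrarily small. The hatted matrices of the algorithm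
  are computed versions of these dominating matrices; this is why the ratios compare relative
  errors. Two facts keep the constants low. Taking absolute values does not increase the spectral
  norm of a triangular matrix, and |V|^T and |U| enter only through single rows and columns, which
  have norm 1, while the whole matrices may have norm sqrt 2. The triple (K, L, P) needs no separate
  argument: K takes the place of G and L that of H.\<close>

lemma matmul_nth: "(X ** Y) $ i $ j = X$i$1 * Y$1$j + X$i$2 * Y$2$j" for X Y :: rmat2
  by (simp add: matrix_matrix_mult_def sum_2)

lemma matvec_nth: "(X *v x) $ i = X$i$1 * x$1 + X$i$2 * x$2" for X :: rmat2
  by (simp add: matrix_vector_mult_def sum_2)

lemma mat2_nth [simp]:
  "mat2 a b c d $ 1 $ 1 = a" "mat2 a b c d $ 1 $ 2 = b"
  "mat2 a b c d $ 2 $ 1 = c" "mat2 a b c d $ 2 $ 2 = d"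
  by (simp_all add: mat2_def)

lemma adj2_nth [simp]:
  "adj2 X $ 1 $ 1 = X$2$2" "adj2 X $ 1 $ 2 = - (X$1$2)"
  "adj2 X $ 2 $ 1 = - (X$2$1)" "adj2 X $ 2 $ 2 = X$1$1"
  by (simp_all add: adj2_def)

lemma J2_nth [simp]: "J2$1$1 = 0" "J2$1$2 = 1" "J2$2$1 = -1" "J2$2$2 = 0"
  by (simp_all add: J2_def)

lemma zero_entry_nth: "zero_entry r s X $ i $ j = (if i = r \<and> j = s then 0 else X$i$j)"
  by (simp add: zero_entry_def)

lemma abs_mat_nth [simp]: "abs_mat X $ i $ j = \<bar>X$i$j\<bar>"
  by (simp add: abs_mat_def)

lemma transpose_nth [simp]: "transpose X $ i $ j = X$j$i"
  by (simp add: transpose_def)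

lemma rmat2_eq_iff: "X = Y \<longleftrightarrow> X$1$1 = Y$1$1 \<and> X$1$2 = Y$1$2 \<and> X$2$1 = Y$2$1 \<and> X$2$2 = Y$2$2"
  for X Y :: rmat2
  by (auto simp: vec_eq_iff forall_2)

lemma norm_real2: "norm x = sqrt ((x$1)\<^sup>2 + (x$2)\<^sup>2)" for x :: "real^2"
  by (simp add: norm_vec_def L2_set_def sum_2)

lemma norm_real2_le_abs: "norm x \<le> \<bar>x$1\<bar> + \<bar>x$2\<bar>" for x :: "real^2"
  using norm_le_l1_cart[of x] by (simp add: sum_2)

lemma abs_le_sqrt2_norm: "\<bar>x$1\<bar> + \<bar>x$2\<bar> \<le> sqrt 2 * norm x" for x :: "real^2"
proof -
  have "(\<bar>x$1\<bar> + \<bar>x$2\<bar>)\<^sup>2 \<le> 2 * ((x$1)\<^sup>2 + (x$2)\<^sup>2)"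
    using zero_le_power2[of "\<bar>x$1\<bar> - \<bar>x$2\<bar>"] by (simp add: power2_sum power2_diff)
  from real_le_rsqrt[OF this] show ?thesis
    by (simp only: norm_real2 real_sqrt_mult)
qed

lemma norm_le_componentwise: "(\<And>i. \<bar>x$i\<bar> \<le> y$i) \<Longrightarrow> norm x \<le> norm y" for x y :: "real^2"
  by (rule norm_le_componentwise_cart) (metis abs_ge_self order_trans real_norm_def)

lemma norm_matvec_le: "norm (X *v x) \<le> spec_norm X * norm x"
  unfolding spec_norm_def by (rule onorm) simp

lemma spec_norm_le: "(\<And>x. norm (X *v x) \<le> b * norm x) \<Longrightarrow> spec_norm X \<le> b"
  unfolding spec_norm_def by (rule onorm_le)

lemma spec_norm_nonneg [simp]: "0 \<le> spec_norm X"
  unfolding spec_norm_def by (rule onorm_pos_le) simp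

lemma spec_norm_add: "spec_norm (X + Y) \<le> spec_norm X + spec_norm Y"
proof (rule spec_norm_le)
  fix x
  show "norm ((X + Y) *v x) \<le> (spec_norm X + spec_norm Y) * norm x"
    using norm_triangle_ineq[of "X *v x" "Y *v x"] norm_matvec_le[of X x] norm_matvec_le[of Y x]
    by (simp add: matrix_vector_mult_add_rdistrib algebra_simps)
qed

lemma spec_norm_mult: "spec_norm (X ** Y) \<le> spec_norm X * spec_norm Y"
proof (rule spec_norm_le)
  fix x
  have "norm (X *v (Y *v x)) \<le> spec_norm X * norm (Y *v x)" by (rule norm_matvec_le)
  also have "\<dots> \<le> spec_norm X * (spec_norm Y * norm x)"
    by (intro mult_left_mono norm_matvec_le) simp
  finally show "norm ((X ** Y) *v x) \<le> spec_norm X * spec_norm Y * norm x"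
    by (simp add: matrix_vector_mul_assoc mult.assoc)
qed

lemma norm_orthogonal_matvec: "orthogonal_matrix Q \<Longrightarrow> norm (Q *v x) = norm x" for Q :: rmat2
  using orthogonal_transformation_matrix[of "(*v) Q"] orthogonal_transformation_norm
  by auto

lemma spec_norm_orthogonal: "orthogonal_matrix Q \<Longrightarrow> spec_norm Q \<le> 1"
  by (rule spec_norm_le) (simp add: norm_orthogonal_matvec)

lemma spec_norm_orthogonal_mult:
  assumes "orthogonal_matrix P" "orthogonal_matrix Q"
  shows "spec_norm (P ** X ** Q) \<le> spec_norm X"
proof -
  have "spec_norm (P ** X ** Q) \<le> spec_norm P * spec_norm X * spec_norm Q"
    by (meson spec_norm_mult mult_right_mono order_trans spec_norm_nonneg)
  also have "\<dots> \<le> 1 * spec_norm X * 1"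
    by (intro mult_mono spec_norm_orthogonal assms) auto
  finally show ?thesis by simp
qed

text \<open>With y = X^T x, the square of the norm of y is the inner product of x and X y; one
  factor cancels.\<close>

lemma spec_norm_transpose [simp]: "spec_norm (transpose X) = spec_norm X"
proof -
  have le: "spec_norm (transpose X) \<le> spec_norm X" for X
  proof (rule spec_norm_le)
    fix x
    let ?y = "transpose X *v x"
    have "norm ?y * norm ?y = x \<bullet> (X *v ?y)"
      by (metis dot_lmul_matrix power2_eq_square power2_norm_eq_inner transpose_matrix_vector)
    also have "\<dots> \<le> norm x * (spec_norm X * norm ?y)"
      by (meson norm_cauchy_schwarz order_trans mult_left_mono norm_matvec_le norm_ge_zero)
    finally show "norm ?y \<le> spec_norm X * norm x"
      by (cases "norm ?y = 0") (auto simp: mult.commute mult.left_commute mult_le_cancel_left)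
  qed
  from le[of X] le[of "transpose X"] show ?thesis by simp
qed

lemma spec_norm_le_norm: "spec_norm X \<le> norm X"
proof (rule spec_norm_le)
  fix x
  have "norm (X *v x) = L2_set (\<lambda>i. \<bar>X$i \<bullet> x\<bar>) UNIV"
    by (simp add: norm_vec_def matrix_vector_mul_component)
  also have "\<dots> \<le> L2_set (\<lambda>i. norm (X$i) * norm x) UNIV"
    by (intro L2_set_mono Cauchy_Schwarz_ineq2) auto
  also have "\<dots> = norm X * norm x"
    by (simp add: norm_vec_def[of X] L2_set_left_distrib)
  finally show "norm (X *v x) \<le> norm X * norm x" .
qed

text \<open>Adding the row norms loses nothing for a matrix with a single nonzero row, such as the
  change made by setting one entry to zero. For a full error matrix it doubles the bound on a
  row.\<close>

lemma spec_norm_le_rows: "spec_norm X \<le> norm (X$1) + norm (X$2)"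
proof -
  have "norm X \<le> (\<Sum>i\<in>UNIV. norm (X$i))"
    unfolding norm_vec_def[of X] by (rule L2_set_le_sum) simp
  then show ?thesis using spec_norm_le_norm[of X] by (simp add: sum_2)
qed

lemma orthogonal_J2: "orthogonal_matrix J2"
  by (simp add: orthogonal_matrix rmat2_eq_iff matmul_nth mat_def)

text \<open>In dimension two the adjugate is the transpose conjugated by the rotation
  \<open>J2\<close>. This is why every bound involving adj(A) can be stated with the norm of
  \<open>A\<close>.\<close>

lemma spec_norm_adj2 [simp]: "spec_norm (adj2 X) = spec_norm X"
proof -
  have le: "spec_norm (adj2 X) \<le> spec_norm X" for X
  proof -
    have "adj2 X = transpose J2 ** transpose X ** J2"
      by (simp add: rmat2_eq_iff matmul_nth)
    then show ?thesis
      using spec_norm_orthogonal_mult[of "transpose J2" J2 "transpose X"] orthogonal_J2 by simp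
  qed
  have "adj2 (adj2 X) = X" by (simp add: rmat2_eq_iff)
  with le[of X] le[of "adj2 X"] show ?thesis by simp
qed

text \<open>The three entries of an upper triangular matrix can be made nonnegative by changing the signs
  of rows and columns.\<close>

lemma spec_norm_abs_mat_upper_tri:
  assumes "upper_tri X"
  shows "spec_norm (abs_mat X) \<le> spec_norm X"
proof -
  define sg :: "real \<Rightarrow> real" where "sg a = (if a < 0 then -1 else 1)" for a
  have sg: "sg a * sg a = 1" "sg a * a = \<bar>a\<bar>" for a by (auto simp: sg_def)
  \<comment> \<open>\<open>E\<close> makes the first row nonnegative. This may flip the sign of the
    (2,2) entry, which \<open>D\<close> corrects without touching the first row. The value
    \<open>sg 0 = 1\<close> keeps both matrices orthogonal when entries vanish.\<close>
  define D where "D = mat2 1 0 0 (sg (X$1$2) * sg (X$2$2))"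
  define E where "E = mat2 (sg (X$1$1)) 0 0 (sg (X$1$2))"
  have *: "sg b * sg c * (sg b * sg c) = 1" for b c
    using sg(1)[of b] sg(1)[of c] by (simp add: algebra_simps)
  have "orthogonal_matrix D" "orthogonal_matrix E"
    by (simp_all add: orthogonal_matrix rmat2_eq_iff matmul_nth mat_def D_def E_def sg * )
  moreover have "abs_mat X = D ** X ** E"
  proof -
    have "sg b * sg c * c * sg b = \<bar>c\<bar>" for b c
      using sg(1)[of b] sg(2)[of c] by (auto simp: sg_def)
    moreover have "X$2$1 = 0" using assms by (simp add: upper_tri_def)
    ultimately show ?thesis
      using sg(2) by (simp add: rmat2_eq_iff matmul_nth D_def E_def mult.commute)
  qed
  ultimately show ?thesis using spec_norm_orthogonal_mult by metis
qed

lemma norm_row_matmul_le: "norm ((X ** Y) $ i) \<le> norm (X$i) * spec_norm Y" for X :: rmat2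
proof -
  have "(X ** Y) $ i = transpose Y *v (X$i)"
    by (simp add: vec_eq_iff forall_2 matmul_nth matvec_nth mult.commute
        del: transpose_matrix_vector)
  then show ?thesis using norm_matvec_le[of "transpose Y" "X$i"] by (simp add: mult.commute)
qed

lemma norm_orthogonal_row: "orthogonal_matrix Q \<Longrightarrow> norm (Q$i) = 1" for Q :: rmat2
  by (metis orthogonal_matrix_orthonormal_rows row_def vec_lambda_eta)

lemma norm_row_orthogonal_mult: "orthogonal_matrix Q \<Longrightarrow> norm ((X ** Q) $ i) = norm (X$i)"
  for X :: rmat2
  using norm_orthogonal_matvec[of "transpose Q" "X$i"]
  by (simp add: matrix_matrix_mult_def matrix_vector_mult_def mult.commute)

text \<open>Cauchy-Schwarz after taking absolute values, which changes neither the norm of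
  \<open>x\<close> nor the unit norm of a column of \<open>Q\<close>. Entrywise errors of a rotated
  row can thus be summed without a factor sqrt 2.\<close>

lemma abs_orthogonal_row_sum_le:
  fixes x :: "real^2" and Q :: rmat2
  assumes "orthogonal_matrix Q"
  shows "\<bar>x$1\<bar> * \<bar>Q$1$j\<bar> + \<bar>x$2\<bar> * \<bar>Q$2$j\<bar> \<le> norm x"
proof -
  let ?x = "(\<chi> k. \<bar>x$k\<bar>) :: real^2" and ?q = "(\<chi> k. \<bar>Q$k$j\<bar>) :: real^2"
  have "norm ?q = norm (transpose Q $ j)" "norm ?x = norm x" by (simp_all add: norm_real2)
  then have "norm ?q = 1" "norm ?x = norm x" using assms by (simp_all add: norm_orthogonal_row)
  moreover have "?x \<bullet> ?q = \<bar>x$1\<bar> * \<bar>Q$1$j\<bar> + \<bar>x$2\<bar> * \<bar>Q$2$j\<bar>" by (simp add: inner_vec_def sum_2)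
  ultimately show ?thesis using norm_cauchy_schwarz[of ?x ?q] by simp
qed

section \<open>Entrywise error bounds\<close>

text \<open>The scale \<open>Y\<close> stands for a product of absolute values such as |V|^T |C|.
  The exact value itself would be useless as a scale after cancellation.\<close>

definition close :: "real \<Rightarrow> rmat2 \<Rightarrow> rmat2 \<Rightarrow> rmat2 \<Rightarrow> bool" where
  "close \<delta> X X\<^sub>0 Y \<longleftrightarrow> (\<forall>i j. \<bar>X$i$j - X\<^sub>0$i$j\<bar> \<le> \<delta> * Y$i$j)"

text \<open>Domination of the exact value by \<open>Y\<close> is what makes the notion stable under
  products. The weaker \<open>close\<close> is still needed for the perturbed factors of
  \<open>M\<close>, which may slightly exceed \<open>Y\<close>.\<close>

definition near :: "real \<Rightarrow> rmat2 \<Rightarrow> rmat2 \<Rightarrow> rmat2 \<Rightarrow> bool" where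
  "near \<delta> X X\<^sub>0 Y \<longleftrightarrow> close \<delta> X X\<^sub>0 Y \<and> (\<forall>i j. \<bar>X\<^sub>0$i$j\<bar> \<le> Y$i$j)"

lemma closeD: "close \<delta> X X\<^sub>0 Y \<Longrightarrow> \<bar>X$i$j - X\<^sub>0$i$j\<bar> \<le> \<delta> * Y$i$j"
  by (simp add: close_def)

lemma near_close: "near \<delta> X X\<^sub>0 Y \<Longrightarrow> close \<delta> X X\<^sub>0 Y"
  by (simp add: near_def)

lemma near_nonneg: "near \<delta> X X\<^sub>0 Y \<Longrightarrow> 0 \<le> Y$i$j"
  by (meson abs_ge_zero near_def order_trans)

lemma near_mono: "near \<delta> X X\<^sub>0 Y \<Longrightarrow> \<delta> \<le> \<delta>' \<Longrightarrow> near \<delta>' X X\<^sub>0 Y"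
  using near_nonneg[of \<delta> X X\<^sub>0 Y]
  by (auto simp: near_def close_def) (meson mult_right_mono order_trans)

lemma near_refl: "near 0 X X (abs_mat X)"
  by (simp add: near_def close_def)

lemma near_abs_mat: "near \<delta> X X\<^sub>0 Y \<Longrightarrow> near \<delta> (abs_mat X) (abs_mat X\<^sub>0) Y"
  by (auto simp: near_def close_def intro: order_trans[OF abs_triangle_ineq3])

lemma near_transpose: "near \<delta> X X\<^sub>0 Y \<Longrightarrow> near \<delta> (transpose X) (transpose X\<^sub>0) (transpose Y)"
  by (simp add: near_def close_def)

lemma near_zero_entry:
  "near \<delta> X X\<^sub>0 Y \<Longrightarrow> \<bar>X\<^sub>0$r$s\<bar> \<le> \<delta> * Y$r$s \<Longrightarrow> near \<delta> (zero_entry r s X) X\<^sub>0 Y"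
  by (simp add: near_def close_def zero_entry_nth)

lemma close_trans:
  assumes "close a X Y W" "close b Y Z W"
  shows "close (a + b) X Z W"
  unfolding close_def
proof (intro allI)
  fix i j
  show "\<bar>X $ i $ j - Z $ i $ j\<bar> \<le> (a + b) * W $ i $ j"
    using closeD[OF assms(1), of i j] closeD[OF assms(2), of i j] by (simp add: distrib_right)
qed

lemma close_sym: "close a X Y W \<Longrightarrow> close a Y X W"
  by (simp add: close_def abs_minus_commute)

lemma close_matmul_left:
  assumes "close \<delta> X X\<^sub>0 Y" shows "close \<delta> (Z ** X) (Z ** X\<^sub>0) (abs_mat Z ** Y)"
  unfolding close_def
proof (intro allI)
  fix i j
  have "\<bar>Z$i$k * (X$k$j - X\<^sub>0$k$j)\<bar> \<le> \<delta> * (\<bar>Z$i$k\<bar> * Y$k$j)" for k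
    using mult_left_mono[OF closeD[OF assms, of k j], of "\<bar>Z$i$k\<bar>"]
    by (simp add: abs_mult mult.left_commute)
  from this[of 1] this[of 2]
  show "\<bar>(Z ** X)$i$j - (Z ** X\<^sub>0)$i$j\<bar> \<le> \<delta> * (abs_mat Z ** Y)$i$j"
    by (simp add: matmul_nth algebra_simps)
qed

lemma close_transpose:
  "close \<delta> X X\<^sub>0 Y \<Longrightarrow> close \<delta> (transpose X) (transpose X\<^sub>0) (transpose Y)"
  by (simp add: close_def)

lemma close_matmul_right:
  assumes "close \<delta> X X\<^sub>0 Y" shows "close \<delta> (X ** Z) (X\<^sub>0 ** Z) (Y ** abs_mat Z)"
proof -
  have "transpose (abs_mat (transpose Z)) = abs_mat Z" by (simp add: rmat2_eq_iff)
  then show ?thesis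
    using close_transpose[OF close_matmul_left[OF close_transpose[OF assms], of "transpose Z"]]
    by (simp add: matrix_transpose_mul)
qed

lemma close_row:
  assumes "close \<delta> X X\<^sub>0 Y" "0 \<le> \<delta>" "norm (Y$i) \<le> N"
  shows "norm ((X - X\<^sub>0)$i) \<le> \<delta> * N"
proof -
  have "norm ((X - X\<^sub>0)$i) \<le> norm (\<delta> *\<^sub>R Y$i)"
    using assms(1) by (intro norm_le_componentwise) (simp add: close_def)
  also have "\<dots> \<le> \<delta> * N" using assms by (simp add: mult_left_mono)
  finally show ?thesis .
qed

lemma near_row:
  assumes "near \<delta> X X\<^sub>0 Y" "0 \<le> \<delta>" "norm (Y$i) \<le> N"
  shows "norm (X$i) \<le> (1 + \<delta>) * N"
proof -
  have "norm (X$i) \<le> norm ((1 + \<delta>) *\<^sub>R Y$i)"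
  proof (rule norm_le_componentwise)
    fix j
    have "\<bar>X\<^sub>0$i$j\<bar> \<le> Y$i$j" "\<bar>X$i$j - X\<^sub>0$i$j\<bar> \<le> \<delta> * Y$i$j"
      using assms(1) by (auto simp: near_def close_def)
    then show "\<bar>X$i$j\<bar> \<le> ((1 + \<delta>) *\<^sub>R Y$i)$j" by (simp add: distrib_right)
  qed
  also have "\<dots> \<le> (1 + \<delta>) * N" using assms by (simp add: mult_left_mono)
  finally show ?thesis .
qed

text \<open>Think of \<open>g\<close> and \<open>h\<close> as computed vectors with orthogonal exact values. If the relative error
  \<open>\<delta> * norm x / norm g\<close> of \<open>g\<close> is at most 1, then the perturbation of the inner product is of first
  order; otherwise \<open>ratio\<close> makes \<open>h\<close> itself small.\<close>

lemma abs_inner_le_of_orthogonal: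
  fixes g g\<^sub>0 x h h\<^sub>0 y :: "real^2"
  assumes g: "\<And>i. \<bar>g$i - g\<^sub>0$i\<bar> \<le> \<delta> * x$i" and h: "\<And>i. \<bar>h$i - h\<^sub>0$i\<bar> \<le> \<delta> * y$i"
    and xy: "\<And>i. 0 \<le> x$i" "\<And>i. 0 \<le> y$i" and orth: "g\<^sub>0 \<bullet> h\<^sub>0 = 0" and "0 \<le> \<delta>"
    and ratio: "(x$1 + x$2) * (\<bar>h$1\<bar> + \<bar>h$2\<bar>) \<le> (11/10) * (y$1 + y$2) * (\<bar>g$1\<bar> + \<bar>g$2\<bar>)"
  shows "\<bar>g \<bullet> h\<bar> \<le> 5 * \<delta> * norm y * norm g"
proof -
  define S where "S = (x$1 + x$2) * (\<bar>h$1\<bar> + \<bar>h$2\<bar>)"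
  have "(y$1 + y$2) * (\<bar>g$1\<bar> + \<bar>g$2\<bar>) \<le> (sqrt 2 * norm y) * (sqrt 2 * norm g)"
    using abs_le_sqrt2_norm[of y] abs_le_sqrt2_norm[of g] xy(2)[of 1] xy(2)[of 2]
    by (intro mult_mono) auto
  also have "\<dots> = 2 * norm y * norm g" by simp
  \<comment> \<open>The ratios are formed with 1-norms. Passing to Euclidean norms costs sqrt 2
    twice, and 2 * 11/10 = 11/5.\<close>
  finally have S: "S \<le> (11/5) * norm y * norm g" using ratio unfolding S_def by linarith
  have \<delta>S: "\<delta> * S \<le> (11/5) * (\<delta> * norm y * norm g)"
    using mult_left_mono[OF S \<open>0 \<le> \<delta>\<close>] by (simp add: algebra_simps)
  have dh: "norm (h - h\<^sub>0) \<le> \<delta> * norm y"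
    using norm_le_componentwise[of "h - h\<^sub>0" "\<delta> *\<^sub>R y"] h \<open>0 \<le> \<delta>\<close> by simp
  have dg: "norm (g - g\<^sub>0) \<le> \<delta> * norm x"
    using norm_le_componentwise[of "g - g\<^sub>0" "\<delta> *\<^sub>R x"] g \<open>0 \<le> \<delta>\<close> by simp
  have nonneg: "0 \<le> \<delta> * norm y * norm g" using \<open>0 \<le> \<delta>\<close> by simp
  show ?thesis
  proof (cases "\<delta> * norm x \<le> norm g")
    case True
    have "\<bar>g \<bullet> (h - h\<^sub>0)\<bar> \<le> \<delta> * norm y * norm g"
      using Cauchy_Schwarz_ineq2[of g "h - h\<^sub>0"] mult_left_mono[OF dh, of "norm g"]
      by (simp add: algebra_simps)
    moreover have "\<bar>(g - g\<^sub>0) \<bullet> h\<bar> \<le> \<delta> * S"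
    proof -
      have "\<bar>(g - g\<^sub>0) \<bullet> h\<bar> \<le> \<bar>g$1 - g\<^sub>0$1\<bar> * \<bar>h$1\<bar> + \<bar>g$2 - g\<^sub>0$2\<bar> * \<bar>h$2\<bar>"
        by (simp add: inner_vec_def sum_2 flip: abs_mult)
      also have "\<dots> \<le> (\<delta> * x$1) * \<bar>h$1\<bar> + (\<delta> * x$2) * \<bar>h$2\<bar>"
        by (intro add_mono mult_right_mono g) auto
      also have "\<dots> \<le> \<delta> * S"
        using xy(1)[of 1] xy(1)[of 2] \<open>0 \<le> \<delta>\<close> by (simp add: S_def algebra_simps)
      finally show ?thesis .
    qed
    moreover have "\<bar>(g - g\<^sub>0) \<bullet> (h - h\<^sub>0)\<bar> \<le> \<delta> * norm y * norm g"
    proof -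
      have "\<bar>(g - g\<^sub>0) \<bullet> (h - h\<^sub>0)\<bar> \<le> norm (g - g\<^sub>0) * norm (h - h\<^sub>0)"
        by (rule Cauchy_Schwarz_ineq2)
      also have "\<dots> \<le> norm g * (\<delta> * norm y)"
        using dg dh True by (intro mult_mono) auto
      finally show ?thesis by (simp add: algebra_simps)
    qed
    \<comment> \<open>The three error terms contribute 1, 11/5 and 1, in total 21/5, which is
      rounded up to 5.\<close>
    moreover have "g \<bullet> h = g \<bullet> (h - h\<^sub>0) + (g - g\<^sub>0) \<bullet> h - (g - g\<^sub>0) \<bullet> (h - h\<^sub>0) + g\<^sub>0 \<bullet> h\<^sub>0"
      by (simp add: inner_diff_left inner_diff_right)
    ultimately have "\<bar>g \<bullet> h\<bar> \<le> 5 * (\<delta> * norm y * norm g)" using orth \<delta>S nonneg by argo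
    then show ?thesis by (simp add: mult.assoc)
  next
    case False
    have "norm x \<le> x$1 + x$2"
      using norm_real2_le_abs[of x] xy(1)[of 1] xy(1)[of 2] by simp
    from mult_left_mono[OF this \<open>0 \<le> \<delta>\<close>] False
    \<comment> \<open>Here \<open>g\<close> is smaller than its own error bound. Replacing it by
      that bound in Cauchy-Schwarz already produces \<delta> times \<open>S\<close>, which
      \<open>ratio\<close> controls.\<close>
    have g_le: "norm g \<le> \<delta> * (x$1 + x$2)" by linarith
    then have pos: "0 \<le> \<delta> * (x$1 + x$2)" using norm_ge_zero[of g] by linarith
    have "\<bar>g \<bullet> h\<bar> \<le> norm g * norm h" by (rule Cauchy_Schwarz_ineq2)
    also have "\<dots> \<le> (\<delta> * (x$1 + x$2)) * (\<bar>h$1\<bar> + \<bar>h$2\<bar>)"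
      using g_le pos norm_real2_le_abs[of h] by (intro mult_mono) auto
    also have "\<dots> = \<delta> * S" by (simp add: S_def)
    finally show ?thesis using \<delta>S nonneg by simp
  qed
qed

section \<open>Floating-point operations\<close>

lemma rel_approxD: "rel_approx \<delta> x y \<Longrightarrow> \<bar>y - x\<bar> \<le> \<delta> * \<bar>x\<bar>"
  by (auto simp: rel_approx_def distrib_left abs_mult mult.commute mult_right_mono)

text \<open>The model of xLASV2 stays an explicit hypothesis of later lemmas, because it also
  depends on the flags of the algorithm.\<close>

locale fp_model =
  fixes \<epsilon> :: real and fp :: fp_env
  assumes eps_pos: "0 < \<epsilon>" and eps_small: "\<epsilon> \<le> 1 / 10^6"
    and ops: "fl_ops_model \<epsilon> fp" and lartg: "xlartg_model \<epsilon> fp"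
begin

lemma eps_sq: "\<epsilon> * \<epsilon> \<le> \<epsilon> / 10^6"
  using mult_left_mono[OF eps_small, of \<epsilon>] eps_pos by simp

lemma fl_nums_const: "0 \<in> fl_nums fp" "1 \<in> fl_nums fp" "-1 \<in> fl_nums fp"
  using ops by (auto simp: fl_ops_model_def)

lemma fl_nums_minus: "a \<in> fl_nums fp \<Longrightarrow> - a \<in> fl_nums fp"
  using ops fl_nums_const unfolding fl_ops_model_def by metis

lemma fl_nums_abs: "a \<in> fl_nums fp \<Longrightarrow> \<bar>a\<bar> \<in> fl_nums fp"
  by (simp add: abs_if fl_nums_minus)

lemma fl_nums_ops:
  assumes "a \<in> fl_nums fp" "b \<in> fl_nums fp"
  shows "fl_add fp a b \<in> fl_nums fp" "fl_sub fp a b \<in> fl_nums fp" "fl_mul fp a b \<in> fl_nums fp"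
  using ops assms by (auto simp: fl_ops_model_def)

lemma rel_approx_ops:
  assumes "a \<in> fl_nums fp" "b \<in> fl_nums fp"
  shows "rel_approx \<epsilon> (a + b) (fl_add fp a b)" "rel_approx \<epsilon> (a - b) (fl_sub fp a b)"
    "rel_approx \<epsilon> (a * b) (fl_mul fp a b)" "b \<noteq> 0 \<Longrightarrow> rel_approx \<epsilon> (a / b) (fl_div fp a b)"
  using ops assms by (auto simp: fl_ops_model_def)

lemma fl_mul_zero:
  assumes "a \<in> fl_nums fp" shows "fl_mul fp 0 a = 0" "fl_mul fp a 0 = 0"
  using rel_approxD[OF rel_approx_ops(3)[OF fl_nums_const(1) assms]]
    rel_approxD[OF rel_approx_ops(3)[OF assms fl_nums_const(1)]] by auto

lemma fl_add_zero: "fl_add fp 0 0 = 0"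
  using rel_approxD[OF rel_approx_ops(1)[OF fl_nums_const(1) fl_nums_const(1)]] by auto

text \<open>The sum has nonnegative terms and its rounding factor is nonzero. Hence the zero tests
  of the algorithm, although made on computed sums, are exact.\<close>

lemma fl_add_abs_eq_0_iff:
  assumes "a \<in> fl_nums fp" "b \<in> fl_nums fp"
  shows "fl_add fp \<bar>a\<bar> \<bar>b\<bar> = 0 \<longleftrightarrow> a = 0 \<and> b = 0"
proof -
  obtain e where e: "\<bar>e\<bar> \<le> \<epsilon>" "fl_add fp \<bar>a\<bar> \<bar>b\<bar> = (\<bar>a\<bar> + \<bar>b\<bar>) * (1 + e)"
    using rel_approx_ops(1)[OF assms[THEN fl_nums_abs]] by (auto simp: rel_approx_def)
  moreover have "1 + e \<noteq> 0" using e(1) eps_small by auto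
  ultimately show ?thesis by auto
qed

lemma fl_mat_nth: "fl_mat fp X \<Longrightarrow> X$i$j \<in> fl_nums fp"
  by (simp add: fl_mat_def)

lemma fl_mat_transpose: "fl_mat fp X \<Longrightarrow> fl_mat fp (transpose X)"
  by (simp add: fl_mat_def)

lemma fl_mat_abs_mat: "fl_mat fp X \<Longrightarrow> fl_mat fp (abs_mat X)"
  by (simp add: fl_mat_def fl_nums_abs)

lemma fl_mat_zero_entry: "fl_mat fp X \<Longrightarrow> fl_mat fp (zero_entry r s X)"
  by (simp add: fl_mat_def zero_entry_nth fl_nums_const)

lemma fl_mat_adj2: "fl_mat fp X \<Longrightarrow> fl_mat fp (adj2 X)"
  by (simp add: fl_mat_def forall_2 fl_nums_minus)

lemma fl_mat_J2: "fl_mat fp J2"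
  by (simp add: fl_mat_def forall_2 fl_nums_const)

lemma fl_mat_matmul_J2: "fl_mat fp X \<Longrightarrow> fl_mat fp (X ** J2)"
  by (simp add: fl_mat_def forall_2 matmul_nth fl_nums_minus)

lemma fl_mat_matmul: "fl_mat fp X \<Longrightarrow> fl_mat fp Y \<Longrightarrow> fl_mat fp (fl_matmul fp X Y)"
  by (simp add: fl_mat_def fl_matmul_def fl_nums_ops)

text \<open>Each term is rounded once as a product and once in the sum. This gives 2 to first order,
  and 1/2 is left for the second-order part.\<close>

lemma fl_matmul_close:
  assumes "fl_mat fp X" "fl_mat fp Y"
  shows "close ((5/2) * \<epsilon>) (fl_matmul fp X Y) (X ** Y) (abs_mat X ** abs_mat Y)"
  unfolding close_def
proof (intro allI)
  fix i j
  let ?a = "X$i$1 * Y$1$j" and ?b = "X$i$2 * Y$2$j"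
  let ?p = "fl_mul fp (X$i$1) (Y$1$j)" and ?q = "fl_mul fp (X$i$2) (Y$2$j)"
  note fl = fl_mat_nth[OF assms(1)] fl_mat_nth[OF assms(2)]
  have p: "\<bar>?p - ?a\<bar> \<le> \<epsilon> * \<bar>?a\<bar>" and q: "\<bar>?q - ?b\<bar> \<le> \<epsilon> * \<bar>?b\<bar>"
    by (intro rel_approxD rel_approx_ops fl)+
  have r: "\<bar>fl_add fp ?p ?q - (?p + ?q)\<bar> \<le> \<epsilon> * \<bar>?p + ?q\<bar>"
    by (intro rel_approxD rel_approx_ops fl_nums_ops fl)
  have "\<bar>?p + ?q\<bar> \<le> (11/10) * (\<bar>?a\<bar> + \<bar>?b\<bar>)"
  proof -
    have "\<epsilon> * \<bar>?a\<bar> \<le> (1/1000) * \<bar>?a\<bar>" "\<epsilon> * \<bar>?b\<bar> \<le> (1/1000) * \<bar>?b\<bar>"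
      using eps_small by (intro mult_right_mono; simp)+
    with p q show ?thesis by argo
  qed
  from mult_left_mono[OF this, of \<epsilon>] eps_pos
  have "\<epsilon> * \<bar>?p + ?q\<bar> \<le> (11/10) * (\<epsilon> * \<bar>?a\<bar> + \<epsilon> * \<bar>?b\<bar>)" by (simp add: algebra_simps)
  moreover have "0 \<le> \<epsilon> * \<bar>?a\<bar>" "0 \<le> \<epsilon> * \<bar>?b\<bar>" using eps_pos by auto
  ultimately have "\<bar>fl_add fp ?p ?q - (?a + ?b)\<bar> \<le> (5/2) * (\<epsilon> * \<bar>?a\<bar> + \<epsilon> * \<bar>?b\<bar>)"
    using p q r by argo
  then show "\<bar>fl_matmul fp X Y $ i $ j - (X ** Y) $ i $ j\<bar>
      \<le> (5/2) * \<epsilon> * (abs_mat X ** abs_mat Y) $ i $ j"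
    by (simp add: fl_matmul_def matmul_nth abs_mult algebra_simps)
qed

text \<open>Relative errors add under multiplication. The extra 3 consists of 1/10 for the product
  of the two incoming errors and 5/2 * 11/10 for the rounding of the product itself. The limit 60
  exceeds every incoming error that occurs and keeps the second-order term below 1/10.\<close>

lemma near_fl_matmul:
  assumes X: "near (a * \<epsilon>) X X\<^sub>0 Y" and Z: "near (b * \<epsilon>) Z Z\<^sub>0 W"
    and fl: "fl_mat fp X" "fl_mat fp Z" and ab: "0 \<le> a" "a \<le> 60" "0 \<le> b" "b \<le> 60"
  shows "near ((a + b + 3) * \<epsilon>) (fl_matmul fp X Z) (X\<^sub>0 ** Z\<^sub>0) (Y ** W)"
proof -
  have ab\<epsilon>: "0 \<le> a * \<epsilon>" "a * \<epsilon> \<le> 60 * \<epsilon>" "0 \<le> b * \<epsilon>" "b * \<epsilon> \<le> 60 * \<epsilon>"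
    using ab eps_pos by auto
  have prod: "\<bar>x * z - x0 * z0\<bar> \<le> (a + b + (1/10)) * \<epsilon> * (y * w) \<and> \<bar>x\<bar> * \<bar>z\<bar> \<le> (11/10) * (y * w)"
    if "\<bar>x - x0\<bar> \<le> (a * \<epsilon>) * y" "\<bar>x0\<bar> \<le> y" "\<bar>z - z0\<bar> \<le> (b * \<epsilon>) * w" "\<bar>z0\<bar> \<le> w"
    for x x0 y z z0 w :: real
  proof
    have yw: "0 \<le> y" "0 \<le> w" using that by auto
    have z: "\<bar>z\<bar> \<le> (1 + b * \<epsilon>) * w" and x: "\<bar>x\<bar> \<le> (1 + a * \<epsilon>) * y"
      using that by (simp_all add: distrib_right)
    have "x * z - x0 * z0 = (x - x0) * z + x0 * (z - z0)" by (simp add: algebra_simps)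
    also have "\<bar>\<dots>\<bar> \<le> \<bar>x - x0\<bar> * \<bar>z\<bar> + \<bar>x0\<bar> * \<bar>z - z0\<bar>"
      by (metis abs_mult abs_triangle_ineq)
    also have "\<dots> \<le> ((a * \<epsilon>) * y) * ((1 + b * \<epsilon>) * w) + y * ((b * \<epsilon>) * w)"
      using that yw z ab\<epsilon> by (intro add_mono mult_mono) auto
    also have "\<dots> = (a * \<epsilon> + b * \<epsilon> + (a * \<epsilon>) * (b * \<epsilon>)) * (y * w)" by (simp add: algebra_simps)
    also have "\<dots> \<le> (a + b + (1/10)) * \<epsilon> * (y * w)"
    proof (rule mult_right_mono)
      have "(a * \<epsilon>) * (b * \<epsilon>) \<le> (60 * \<epsilon>) * (60 * \<epsilon>)" using ab\<epsilon> eps_pos by (intro mult_mono) auto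
      also have "\<dots> \<le> (1/10) * \<epsilon>" using eps_sq eps_pos by simp
      finally show "a * \<epsilon> + b * \<epsilon> + (a * \<epsilon>) * (b * \<epsilon>) \<le> (a + b + (1/10)) * \<epsilon>"
        by (simp add: distrib_right)
    qed (use yw in simp)
    finally show "\<bar>x * z - x0 * z0\<bar> \<le> (a + b + (1/10)) * \<epsilon> * (y * w)" .
    have "\<bar>x\<bar> * \<bar>z\<bar> \<le> ((101/100) * y) * ((101/100) * w)"
    proof (intro mult_mono)
      have "a * \<epsilon> \<le> (1/100)" "b * \<epsilon> \<le> (1/100)" using ab\<epsilon> eps_small by auto
      with yw have "(1 + a * \<epsilon>) * y \<le> (101/100) * y" "(1 + b * \<epsilon>) * w \<le> (101/100) * w"
        by (intro mult_right_mono; simp)+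
      with x z show "\<bar>x\<bar> \<le> (101/100) * y" "\<bar>z\<bar> \<le> (101/100) * w" by linarith+
    qed (use yw in auto)
    also have "\<dots> \<le> (11/10) * (y * w)" using yw by simp
    finally show "\<bar>x\<bar> * \<bar>z\<bar> \<le> (11/10) * (y * w)" .
  qed
  have P: "\<bar>X$i$k * Z$k$j - X\<^sub>0$i$k * Z\<^sub>0$k$j\<bar> \<le> (a + b + (1/10)) * \<epsilon> * (Y$i$k * W$k$j) \<and>
      \<bar>X$i$k\<bar> * \<bar>Z$k$j\<bar> \<le> (11/10) * (Y$i$k * W$k$j)" for i j k
    using X Z by (intro prod) (auto simp: near_def close_def)
  show ?thesis
    unfolding near_def close_def
  proof (intro conjI allI)
    fix i j
    let ?S = "(Y ** W)$i$j"
    have "\<bar>(X ** Z)$i$j - (X\<^sub>0 ** Z\<^sub>0)$i$j\<bar> \<le> (a + b + (1/10)) * \<epsilon> * ?S"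
      using P[of i 1 j] P[of i 2 j] unfolding matmul_nth distrib_left by linarith
    moreover have "\<bar>fl_matmul fp X Z $ i $ j - (X ** Z) $ i $ j\<bar> \<le> (11/4) * (\<epsilon> * ?S)"
    proof -
      have "(abs_mat X ** abs_mat Z)$i$j \<le> (11/10) * ?S"
        using P[of i 1 j] P[of i 2 j] unfolding matmul_nth distrib_left by simp
      from mult_left_mono[OF this, of "(5/2) * \<epsilon>"] eps_pos
      have "(5/2) * \<epsilon> * (abs_mat X ** abs_mat Z)$i$j \<le> (11/4) * (\<epsilon> * ?S)" by simp
      moreover have "0 \<le> \<epsilon> * ?S"
        using eps_pos near_nonneg[OF X] near_nonneg[OF Z] by (simp add: matmul_nth)
      ultimately show ?thesis using closeD[OF fl_matmul_close[OF fl], of i j] by linarith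
    qed
    moreover have "0 \<le> \<epsilon> * ?S"
      using eps_pos near_nonneg[OF X] near_nonneg[OF Z] by (simp add: matmul_nth)
    moreover have "(a + b + (1/10)) * \<epsilon> * ?S = (a + b) * \<epsilon> * ?S + (1/10) * (\<epsilon> * ?S)"
      "(a + b + 3) * \<epsilon> * ?S = (a + b) * \<epsilon> * ?S + 3 * (\<epsilon> * ?S)"
      by (simp_all add: distrib_right)
    ultimately show "\<bar>fl_matmul fp X Z $ i $ j - (X\<^sub>0 ** Z\<^sub>0) $ i $ j\<bar> \<le> (a + b + 3) * \<epsilon> * ?S"
      by linarith
    show "\<bar>(X\<^sub>0 ** Z\<^sub>0) $ i $ j\<bar> \<le> ?S"
    proof -
      have "\<bar>X\<^sub>0$i$k * Z\<^sub>0$k$j\<bar> \<le> Y$i$k * W$k$j" for k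
        using X Z near_nonneg[OF X] unfolding abs_mult by (intro mult_mono) (auto simp: near_def)
      from this[of 1] this[of 2] show ?thesis by (simp add: matmul_nth)
    qed
  qed
qed

end

section \<open>Rotations and pairs of matrices with a diagonal product\<close>

lemma transpose_diff: "transpose (X - Y) = transpose X - transpose Y" for X Y :: rmat2
  by (simp add: vec_eq_iff)

context fp_model
begin

section \<open>Comparison of the computed ratios\<close>

lemma fl_eta_bounds:
  assumes fl: "x \<in> fl_nums fp" "y \<in> fl_nums fp" "xh \<in> fl_nums fp" "yh \<in> fl_nums fp"
    and xh: "\<bar>xh - x\<^sub>0\<bar> \<le> 60 * \<epsilon> * x\<^sub>0" "0 \<le> x\<^sub>0" and yh: "\<bar>yh - y\<^sub>0\<bar> \<le> 60 * \<epsilon> * y\<^sub>0" "0 \<le> y\<^sub>0"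
    and nz: "x \<noteq> 0 \<or> y \<noteq> 0"
  obtains r where "fl_eta fp xh yh x y = ereal r"
    "99 / 100 * (x\<^sub>0 + y\<^sub>0) \<le> r * (\<bar>x\<bar> + \<bar>y\<bar>)" "r * (\<bar>x\<bar> + \<bar>y\<bar>) \<le> 101 / 100 * (x\<^sub>0 + y\<^sub>0)"
proof -
  define p where "p = fl_add fp xh yh"
  define d where "d = fl_add fp \<bar>x\<bar> \<bar>y\<bar>"
  let ?n = "\<bar>x\<bar> + \<bar>y\<bar>"
  have n: "0 < ?n" using nz by auto
  have d0: "d \<noteq> 0" using fl_add_abs_eq_0_iff[OF fl(1,2)] nz by (auto simp: d_def)
  have pd: "p \<in> fl_nums fp" "d \<in> fl_nums fp"
    unfolding p_def d_def by (intro fl_nums_ops fl_nums_abs fl)+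
  obtain e1 where e1: "\<bar>e1\<bar> \<le> \<epsilon>" "p = (xh + yh) * (1 + e1)"
    using rel_approx_ops(1)[OF fl(3,4)] by (auto simp: rel_approx_def p_def)
  obtain e2 where e2: "\<bar>e2\<bar> \<le> \<epsilon>" "d = ?n * (1 + e2)"
    using rel_approx_ops(1)[OF fl(1,2)[THEN fl_nums_abs]] by (auto simp: rel_approx_def d_def)
  obtain e3 where e3: "\<bar>e3\<bar> \<le> \<epsilon>" "fl_div fp p d = p / d * (1 + e3)"
    using rel_approx_ops(4)[OF pd d0] by (auto simp: rel_approx_def)
  \<comment> \<open>\<open>t\<close> collects the three roundings, of the two sums and of the
    quotient. Multiplied by the denominator, the computed ratio becomes \<open>t\<close> times the
    sum of the hatted entries, so that all bounds are free of divisions.\<close>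
  define t where "t = (1 + e1) * (1 + e3) / (1 + e2)"
  have e: "999/1000 \<le> 1 + e" "1 + e \<le> 1001/1000" if "\<bar>e\<bar> \<le> \<epsilon>" for e
    using that eps_small by (auto simp: abs_le_iff)
  note e' = e[OF e1(1)] e[OF e2(1)] e[OF e3(1)]
  have "(999/1000) * (999/1000) \<le> (1 + e1) * (1 + e3)" "(1 + e1) * (1 + e3) \<le> (1001/1000) * (1001/1000)"
    using e' by (intro mult_mono; simp)+
  then have t: "995/1000 \<le> t" "t \<le> 1005/1000"
    using e' by (simp_all add: t_def field_simps)
  let ?s = "x\<^sub>0 + y\<^sub>0"
  have q: "\<bar>(xh + yh) - ?s\<bar> \<le> 1/1000 * ?s"
  proof -
    have "60 * \<epsilon> * x\<^sub>0 \<le> 1/1000 * x\<^sub>0" "60 * \<epsilon> * y\<^sub>0 \<le> 1/1000 * y\<^sub>0"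
      using eps_small xh yh by (intro mult_right_mono; simp)+
    with xh yh show ?thesis unfolding abs_le_iff by (auto simp: algebra_simps)
  qed
  have "p / d * (1 + e3) * ?n = t * (xh + yh)"
    using n e' by (simp add: e2(2) e1(2) t_def)
  then have rn: "fl_div fp p d * ?n = t * (xh + yh)" by (simp only: e3(2))
  have s: "0 \<le> ?s" using xh yh by simp
  have q': "999/1000 * ?s \<le> xh + yh" using q by argo
  have q'': "xh + yh \<le> 1001/1000 * ?s" using q by argo
  show thesis
  proof (rule that)
    show "fl_eta fp xh yh x y = ereal (fl_div fp p d)"
      using d0 by (simp add: fl_eta_def p_def d_def)
    have "995/1000 * (999/1000 * ?s) \<le> t * (xh + yh)" "t * (xh + yh) \<le> 1005/1000 * (1001/1000 * ?s)"
      using t q' q'' s by (intro mult_mono; simp)+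
    then show "99 / 100 * ?s \<le> fl_div fp p d * ?n" "fl_div fp p d * ?n \<le> 101 / 100 * ?s"
      unfolding rn using s by linarith+
  qed
qed

text \<open>The comparison of two computed ratios is turned into a cross-multiplied inequality
  between exact dominating entries. Each ratio is correct up to one percent, and 101/99 is below
  11/10.\<close>

lemma fl_eta_leD:
  assumes fl: "x \<in> fl_nums fp" "y \<in> fl_nums fp" "xh \<in> fl_nums fp" "yh \<in> fl_nums fp"
    and xh: "\<bar>xh - x\<^sub>0\<bar> \<le> 60 * \<epsilon> * x\<^sub>0" "0 \<le> x\<^sub>0" and yh: "\<bar>yh - y\<^sub>0\<bar> \<le> 60 * \<epsilon> * y\<^sub>0" "0 \<le> y\<^sub>0"
    and fl': "u \<in> fl_nums fp" "v \<in> fl_nums fp" "uh \<in> fl_nums fp" "vh \<in> fl_nums fp"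
    and uh: "\<bar>uh - u\<^sub>0\<bar> \<le> 60 * \<epsilon> * u\<^sub>0" "0 \<le> u\<^sub>0" and vh: "\<bar>vh - v\<^sub>0\<bar> \<le> 60 * \<epsilon> * v\<^sub>0" "0 \<le> v\<^sub>0"
    and le: "fl_eta fp xh yh x y \<le> fl_eta fp uh vh u v"
  shows "(x\<^sub>0 + y\<^sub>0) * (\<bar>u\<bar> + \<bar>v\<bar>) \<le> 11 / 10 * (u\<^sub>0 + v\<^sub>0) * (\<bar>x\<bar> + \<bar>y\<bar>)"
proof (cases "u = 0 \<and> v = 0")
  case True
  then show ?thesis using uh vh by simp
next
  case False
  let ?n = "\<bar>x\<bar> + \<bar>y\<bar>" and ?m = "\<bar>u\<bar> + \<bar>v\<bar>"
  obtain r' where r': "fl_eta fp uh vh u v = ereal r'" "r' * ?m \<le> 101 / 100 * (u\<^sub>0 + v\<^sub>0)"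
    using fl_eta_bounds[OF fl' uh vh] False by blast
  \<comment> \<open>The ratio on the right is finite. A vanishing denominator on the left would make
    the left ratio infinite and contradict \<open>le\<close>.\<close>
  have "x \<noteq> 0 \<or> y \<noteq> 0"
    using le r' fl_add_zero by (auto simp: fl_eta_def Let_def)
  then obtain r where r: "fl_eta fp xh yh x y = ereal r" "99 / 100 * (x\<^sub>0 + y\<^sub>0) \<le> r * ?n"
    using fl_eta_bounds[OF fl xh yh] by blast
  have "r \<le> r'" using le r r' by simp
  have "99 / 100 * (x\<^sub>0 + y\<^sub>0) * ?m \<le> r * ?n * ?m"
    using r(2) by (intro mult_right_mono) auto
  also have "\<dots> \<le> r' * ?m * ?n"
    using mult_right_mono[OF \<open>r \<le> r'\<close>, of "?n * ?m"] by (simp add: mult.assoc mult.commute mult.left_commute)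
  also have "\<dots> \<le> 101 / 100 * (u\<^sub>0 + v\<^sub>0) * ?n"
    using r'(2) by (intro mult_right_mono) auto
  finally have "99 / 100 * ((x\<^sub>0 + y\<^sub>0) * ?m) \<le> 101 / 100 * ((u\<^sub>0 + v\<^sub>0) * ?n)"
    by (simp only: mult.assoc)
  moreover have "0 \<le> (u\<^sub>0 + v\<^sub>0) * ?n" using uh vh by simp
  ultimately have "(x\<^sub>0 + y\<^sub>0) * ?m \<le> 11 / 10 * ((u\<^sub>0 + v\<^sub>0) * ?n)" by argo
  then show ?thesis by (simp only: mult.assoc)
qed

section \<open>Computed rotations and rotated matrices\<close>

lemma lartg_rotation:
  assumes "x \<in> fl_nums fp" "y \<in> fl_nums fp" "xlartg fp x y = (c, s)"
  obtains c\<^sub>0 s\<^sub>0 where "c \<in> fl_nums fp" "s \<in> fl_nums fp" "c\<^sub>0\<^sup>2 + s\<^sub>0\<^sup>2 = 1"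
    "\<bar>c - c\<^sub>0\<bar> \<le> 6 * \<epsilon> * \<bar>c\<^sub>0\<bar>" "\<bar>s - s\<^sub>0\<bar> \<le> 6 * \<epsilon> * \<bar>s\<^sub>0\<bar>"
    "x = sqrt (x\<^sup>2 + y\<^sup>2) * c\<^sub>0" "y = sqrt (x\<^sup>2 + y\<^sup>2) * s\<^sub>0"
proof (cases "x = 0 \<and> y = 0")
  case True
  have "c \<in> fl_nums fp \<and> s \<in> fl_nums fp \<and> c = 1 \<and> s = 0"
    using lartg assms True unfolding xlartg_model_def by metis
  \<comment> \<open>For two zero arguments the square root is 0, so the identity rotation satisfies
    the last two equations as well. Later arguments need no separate case for it.\<close>
  then show thesis using True eps_pos by (intro that[of 1 0]) auto
next
  case False
  let ?r = "sqrt (x\<^sup>2 + y\<^sup>2)"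
  have r: "x\<^sup>2 + y\<^sup>2 \<noteq> 0" using False by (simp add: sum_power2_eq_zero_iff)
  have *: "c \<in> fl_nums fp" "s \<in> fl_nums fp" "rel_approx (6 * \<epsilon>) (x / ?r) c" "rel_approx (6 * \<epsilon>) (y / ?r) s"
    using lartg assms False unfolding xlartg_model_def by metis+
  show thesis
  proof (rule that[of "x / ?r" "y / ?r"])
    show "(x / ?r)\<^sup>2 + (y / ?r)\<^sup>2 = 1"
      using r by (simp add: power_divide add_divide_distrib[symmetric])
  qed (use * r rel_approxD[OF *(3)] rel_approxD[OF *(4)] in auto)
qed

text \<open>The exact rotation has the normalized vector (x, y) as its first column. The two
  equations with the square root let an inner product with (x, y) be read as its norm times an entry
  of a rotated matrix; the last equation is the annihilation.\<close>

lemma rot_to_first_near: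
  assumes "x \<in> fl_nums fp" "y \<in> fl_nums fp"
  obtains Q where "fl_mat fp (rot_to_first fp x y)" "orthogonal_matrix Q"
    "near (6 * \<epsilon>) (rot_to_first fp x y) Q (abs_mat Q)"
    "x = sqrt (x\<^sup>2 + y\<^sup>2) * Q$1$1" "y = sqrt (x\<^sup>2 + y\<^sup>2) * Q$2$1" "x * Q$1$2 + y * Q$2$2 = 0"
proof -
  obtain c s where cs: "xlartg fp x y = (c, s)" by fastforce
  obtain c0 s0 where *: "c \<in> fl_nums fp" "s \<in> fl_nums fp" "c0\<^sup>2 + s0\<^sup>2 = 1"
    "\<bar>c - c0\<bar> \<le> 6 * \<epsilon> * \<bar>c0\<bar>" "\<bar>s - s0\<bar> \<le> 6 * \<epsilon> * \<bar>s0\<bar>"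
    "x = sqrt (x\<^sup>2 + y\<^sup>2) * c0" "y = sqrt (x\<^sup>2 + y\<^sup>2) * s0"
    by (rule lartg_rotation[OF assms cs])
  let ?r = "sqrt (x\<^sup>2 + y\<^sup>2)"
  have "x * (- s0) + y * c0 = (?r * c0) * (- s0) + (?r * s0) * c0"
    using *(6,7) by metis
  then have "x * (- s0) + y * c0 = 0" by simp
  with * show thesis
    by (intro that[of "mat2 c0 (- s0) s0 c0"])
      (auto simp: rot_to_first_def cs fl_mat_def forall_2 fl_nums_minus near_def close_def
        orthogonal_matrix rmat2_eq_iff matmul_nth mat_def power2_eq_square algebra_simps abs_minus_commute)
qed

lemma rot_to_second_near:
  assumes "x \<in> fl_nums fp" "y \<in> fl_nums fp"
  obtains Q where "fl_mat fp (rot_to_second fp x y)" "orthogonal_matrix Q"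
    "near (6 * \<epsilon>) (rot_to_second fp x y) Q (abs_mat Q)"
    "x = sqrt (x\<^sup>2 + y\<^sup>2) * Q$1$2" "y = sqrt (x\<^sup>2 + y\<^sup>2) * Q$2$2" "x * Q$1$1 + y * Q$2$1 = 0"
proof -
  obtain c s where cs: "xlartg fp y x = (c, s)" by fastforce
  obtain c0 s0 where *: "c \<in> fl_nums fp" "s \<in> fl_nums fp" "c0\<^sup>2 + s0\<^sup>2 = 1"
    "\<bar>c - c0\<bar> \<le> 6 * \<epsilon> * \<bar>c0\<bar>" "\<bar>s - s0\<bar> \<le> 6 * \<epsilon> * \<bar>s0\<bar>"
    "y = sqrt (y\<^sup>2 + x\<^sup>2) * c0" "x = sqrt (y\<^sup>2 + x\<^sup>2) * s0"
    by (rule lartg_rotation[OF assms(2,1) cs])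
  let ?r = "sqrt (x\<^sup>2 + y\<^sup>2)"
  have r: "y = ?r * c0" "x = ?r * s0" using *(6,7) by (metis add.commute)+
  then have "x * c0 + y * (- s0) = (?r * s0) * c0 + (?r * c0) * (- s0)" by metis
  then have "x * c0 + y * (- s0) = 0" by simp
  with *(1-5) r show thesis
    by (intro that[of "mat2 c0 s0 (- s0) c0"])
      (auto simp: rot_to_second_def cs fl_mat_def forall_2 fl_nums_minus near_def close_def
        orthogonal_matrix rmat2_eq_iff matmul_nth mat_def power2_eq_square algebra_simps abs_minus_commute)
qed

text \<open>The computed \<open>G\<close> is the reference here, so only the error 6 of the rotation
  and the rounding 5/2 * 11/10 of the product count. Their sum is below 9, and the factor 11/10
  between the norm of a row of \<open>G\<close> and \<open>N\<close> leads to 10.\<close>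

lemma rotated_entry_bound:
  assumes Q: "orthogonal_matrix Q" and R: "near (6 * \<epsilon>) R Q (abs_mat Q)"
    and P: "close (5/2 * \<epsilon>) P (G ** R) (abs_mat G ** abs_mat R)"
    and G: "near (58 * \<epsilon>) G G\<^sub>0 X" and N: "\<And>i. norm (X$i) \<le> N"
  shows "\<bar>P$i$j - (G ** Q)$i$j\<bar> \<le> 10 * \<epsilon> * N"
proof -
  define T where "T = \<bar>G$i$1\<bar> * \<bar>Q$1$j\<bar> + \<bar>G$i$2\<bar> * \<bar>Q$2$j\<bar>"
  have "T \<le> norm (G$i)" using abs_orthogonal_row_sum_le[OF Q, of "G$i" j] by (simp add: T_def)
  also have "\<dots> \<le> (1 + 58 * \<epsilon>) * N" using near_row[OF G _ N] eps_pos by simp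
  also have "\<dots> \<le> 11/10 * N"
    using eps_small order_trans[OF norm_ge_zero N] by (intro mult_right_mono) auto
  finally have T: "T \<le> 11/10 * N" .
  have T0: "0 \<le> T" by (simp add: T_def)
  have "\<bar>(G ** R)$i$j - (G ** Q)$i$j\<bar> \<le> 6 * \<epsilon> * T"
    using closeD[OF close_matmul_left[OF near_close[OF R]], of G i j] by (simp add: T_def matmul_nth)
  moreover have "\<bar>P$i$j - (G ** R)$i$j\<bar> \<le> 5/2 * \<epsilon> * (11/10 * T)"
  proof -
    have "\<bar>R$k$j\<bar> \<le> 11/10 * \<bar>Q$k$j\<bar>" for k
    proof -
      have "6 * \<epsilon> * \<bar>Q$k$j\<bar> \<le> 1/10 * \<bar>Q$k$j\<bar>" using eps_small by (intro mult_right_mono) auto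
      then show ?thesis using closeD[OF near_close[OF R], of k j] by simp
    qed
    then have "\<bar>G$i$k\<bar> * \<bar>R$k$j\<bar> \<le> \<bar>G$i$k\<bar> * (11/10 * \<bar>Q$k$j\<bar>)" for k
      by (intro mult_left_mono) auto
    from this[of 1] this[of 2] have "(abs_mat G ** abs_mat R)$i$j \<le> 11/10 * T"
      by (simp add: matmul_nth T_def)
    with eps_pos have "5/2 * \<epsilon> * (abs_mat G ** abs_mat R)$i$j \<le> 5/2 * \<epsilon> * (11/10 * T)"
      by (intro mult_left_mono) auto
    with closeD[OF P, of i j] show ?thesis by linarith
  qed
  ultimately have "\<bar>P$i$j - (G ** Q)$i$j\<bar> \<le> 9 * (\<epsilon> * T)"
    using mult_nonneg_nonneg[OF less_imp_le[OF eps_pos] T0] by argo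
  also have "\<epsilon> * T \<le> \<epsilon> * (11/10 * N)" using T eps_pos by simp
  finally show ?thesis
    using mult_nonneg_nonneg[OF less_imp_le[OF eps_pos] order_trans[OF norm_ge_zero N]]
    by (simp add: mult.commute)
qed

text \<open>Two entries at 10 and the error 58 of \<open>G\<close> give 78. The reference
  \<open>G\<^sub>1\<close> is left open, since the bound is used both for the unperturbed factor and
  for the factor of \<open>M\<close>.\<close>

lemma rotated_row_bound:
  assumes Q: "orthogonal_matrix Q" and R: "near (6 * \<epsilon>) R Q (abs_mat Q)"
    and P: "close (5/2 * \<epsilon>) P (G ** R) (abs_mat G ** abs_mat R)"
    and G: "near (58 * \<epsilon>) G G\<^sub>0 X" and N: "\<And>i. norm (X$i) \<le> N"
    and G1: "close (58 * \<epsilon>) G G\<^sub>1 X"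
  shows "norm ((P - G\<^sub>1 ** Q)$i) \<le> 80 * \<epsilon> * N"
proof -
  have "(P - G\<^sub>1 ** Q)$i = (P - G ** Q)$i + ((G - G\<^sub>1) ** Q)$i"
    by (simp add: vec_eq_iff forall_2 matmul_nth algebra_simps)
  then have "norm ((P - G\<^sub>1 ** Q)$i) \<le> norm ((P - G ** Q)$i) + norm ((G - G\<^sub>1)$i)"
    using norm_triangle_ineq norm_row_orthogonal_mult[OF Q] by metis
  also have "norm ((P - G ** Q)$i) \<le> 20 * \<epsilon> * N"
    using norm_real2_le_abs[of "(P - G ** Q)$i"] rotated_entry_bound[OF Q R P G N, of i 1]
      rotated_entry_bound[OF Q R P G N, of i 2] by simp
  also have "norm ((G - G\<^sub>1)$i) \<le> 58 * \<epsilon> * N" using close_row[OF G1 _ N] eps_pos by simp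
  also have "20 * \<epsilon> * N + 58 * \<epsilon> * N \<le> 80 * \<epsilon> * N"
    using mult_nonneg_nonneg[OF less_imp_le[OF eps_pos] order_trans[OF norm_ge_zero N]]
    by (simp add: mult.commute)
  finally show ?thesis by simp
qed

text \<open>Two rows at 80 give 160. Setting the entry to zero costs at most 290 + 10, so the total
  is 460.\<close>

lemma rotated_zero_entry_bound:
  assumes Q: "orthogonal_matrix Q" and R: "near (6 * \<epsilon>) R Q (abs_mat Q)"
    and P: "close (5/2 * \<epsilon>) P (G ** R) (abs_mat G ** abs_mat R)"
    and G: "near (58 * \<epsilon>) G G\<^sub>0 X" and N: "\<And>i. norm (X$i) \<le> N"
    and small: "\<bar>(G ** Q)$r$s\<bar> \<le> 290 * \<epsilon> * N"
  shows "spec_norm (zero_entry r s P - G\<^sub>0 ** Q) \<le> 480 * \<epsilon> * N"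
proof -
  let ?Z = "zero_entry r s P - P"
  have "norm (?Z$1) + norm (?Z$2) \<le> \<bar>P$r$s\<bar>"
    using norm_real2_le_abs[of "?Z$1"] norm_real2_le_abs[of "?Z$2"] exhaust_2[of r] exhaust_2[of s]
    by (auto simp: zero_entry_nth)
  moreover have "\<bar>P$r$s\<bar> \<le> 300 * \<epsilon> * N"
    using rotated_entry_bound[OF Q R P G N, of r s] small by simp
  ultimately have Z: "spec_norm ?Z \<le> 300 * \<epsilon> * N"
    using spec_norm_le_rows[of ?Z] by linarith
  have "spec_norm (P - G\<^sub>0 ** Q) \<le> 160 * \<epsilon> * N"
    using spec_norm_le_rows[of "P - G\<^sub>0 ** Q"] rotated_row_bound[OF Q R P G N near_close[OF G], of 1]
      rotated_row_bound[OF Q R P G N near_close[OF G], of 2] by simp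
  moreover have "zero_entry r s P - G\<^sub>0 ** Q = (P - G\<^sub>0 ** Q) + ?Z" by simp
  ultimately have "spec_norm (zero_entry r s P - G\<^sub>0 ** Q) \<le> 460 * \<epsilon> * N"
    using spec_norm_add[of "P - G\<^sub>0 ** Q" ?Z] Z by simp
  also have "\<dots> \<le> 480 * \<epsilon> * N"
    using mult_nonneg_nonneg[OF less_imp_le[OF eps_pos] order_trans[OF norm_ge_zero N]]
    by (simp add: mult.commute)
  finally show ?thesis .
qed

text \<open>The bounds above concern rotations acting from the right. The product of a transposed
  rotation with \<open>H\<close> or \<open>L\<close> is brought to this form by transposition, which
  also turns columns into rows.\<close>

lemma fl_matmul_transpose_close:
  assumes "fl_mat fp X" "fl_mat fp Y"
  shows "close (5/2 * \<epsilon>) (transpose (fl_matmul fp (transpose X) Y))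
    (transpose Y ** X) (abs_mat (transpose Y) ** abs_mat X)"
proof -
  have "transpose (abs_mat Z) = abs_mat (transpose Z)" for Z by (simp add: rmat2_eq_iff)
  with close_transpose[OF fl_matmul_close[OF fl_mat_transpose[OF assms(1)] assms(2)]]
  show ?thesis by (simp add: matrix_transpose_mul)
qed

lemma transpose_zero_entry: "transpose (zero_entry r s X) = zero_entry s r (transpose X)"
  by (auto simp: vec_eq_iff zero_entry_nth)

text \<open>The common form of the assertions about \<open>(G, H, Q)\<close> and about \<open>(K, L, P)\<close>. Rows of \<open>X\<close> are
  parallel to the corresponding rows of \<open>adj2 Y\<close> iff \<open>X ** Y\<close> is diagonal; the first rows already are
  parallel because of the zero entries. In 480, the entry that is set to zero accounts for \<open>5 \<cdot> 58 = 290\<close>.\<close>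

definition stable_pair :: "rmat2 \<Rightarrow> rmat2 \<Rightarrow> real \<Rightarrow> real \<Rightarrow> rmat2 \<Rightarrow> rmat2 \<Rightarrow> bool" where
  "stable_pair G\<^sub>0 H\<^sub>0 N N' G' H' \<longleftrightarrow> lower_tri G' \<and> lower_tri H' \<and>
     (\<exists>Q. orthogonal_matrix Q \<and> spec_norm (G' - G\<^sub>0 ** Q) \<le> 480 * \<epsilon> * N \<and>
        spec_norm (H' - transpose Q ** H\<^sub>0) \<le> 480 * \<epsilon> * N') \<and>
     (\<exists>e f. norm e \<le> 80 * \<epsilon> * N \<and> norm f \<le> 80 * \<epsilon> * N' \<and> (G'$2 + e) \<bullet> (transpose H' $ 1 + f) = 0)"

text \<open>Closeness to \<open>G\<^sub>0\<close> and \<open>H\<^sub>0\<close> yields the backward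
  errors, and closeness to \<open>G\<^sub>1\<close> and \<open>H\<^sub>1\<close>, with their exactly
  diagonal product, yields the orthogonality. The hypothesis \<open>rot\<close> lists the two
  outcomes of the selection: the factor that defines the rotation loses its entry exactly, and the
  ratio bounds the entry of the other factor, unless that factor has only zeros there.\<close>

lemma stable_pairI:
  assumes G: "fl_mat fp G" "near (58 * \<epsilon>) G G\<^sub>0 X" "close (58 * \<epsilon>) G G\<^sub>1 X" "\<And>i. norm (X$i) \<le> N"
    and H: "fl_mat fp H" "near (58 * \<epsilon>) H H\<^sub>0 Y" "close (58 * \<epsilon>) H H\<^sub>1 Y"
      "\<And>i. norm (transpose Y $ i) \<le> N'"
    and diag: "diagonal2 (G\<^sub>1 ** H\<^sub>1)"
    and rot: "R = rot_to_first fp (G$1$1) (G$1$2) \<and>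
        (H$1$2 = 0 \<and> H$2$2 = 0 \<or> (G$1$1 \<noteq> 0 \<or> G$1$2 \<noteq> 0) \<and>
          (X$1$1 + X$1$2) * (\<bar>H$1$2\<bar> + \<bar>H$2$2\<bar>) \<le> 11/10 * (Y$1$2 + Y$2$2) * (\<bar>G$1$1\<bar> + \<bar>G$1$2\<bar>))
      \<or> R = rot_to_second fp (H$1$2) (H$2$2) \<and>
        (G$1$1 = 0 \<and> G$1$2 = 0 \<or> (H$1$2 \<noteq> 0 \<or> H$2$2 \<noteq> 0) \<and>
          (Y$1$2 + Y$2$2) * (\<bar>G$1$1\<bar> + \<bar>G$1$2\<bar>) \<le> 11/10 * (X$1$1 + X$1$2) * (\<bar>H$1$2\<bar> + \<bar>H$2$2\<bar>))"
  shows "stable_pair G\<^sub>0 H\<^sub>0 N N' (zero_entry 1 2 (fl_matmul fp G R))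
    (zero_entry 1 2 (fl_matmul fp (transpose R) H))"
proof -
  let ?g = "G$1" and ?h = "transpose H $ 2" and ?x = "X$1" and ?y = "transpose Y $ 2"
  have N0: "0 \<le> N" "0 \<le> N'" using order_trans[OF norm_ge_zero G(4)] order_trans[OF norm_ge_zero H(4)] .
  have ng: "norm ?g = sqrt ((G$1$1)\<^sup>2 + (G$1$2)\<^sup>2)" and nh: "norm ?h = sqrt ((H$1$2)\<^sup>2 + (H$2$2)\<^sup>2)"
    by (simp_all add: norm_real2)
  have orth: "G\<^sub>1$1 \<bullet> transpose H\<^sub>1 $ 2 = 0"
    using diag by (simp add: diagonal2_def matmul_nth inner_vec_def sum_2)
  have dg: "\<bar>?g$i - G\<^sub>1$1$i\<bar> \<le> (58 * \<epsilon>) * ?x$i" and dh: "\<bar>?h$i - transpose H\<^sub>1 $ 2 $i\<bar> \<le> (58 * \<epsilon>) * ?y$i" for i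
    using closeD[OF G(3)] closeD[OF H(3)] by auto
  have nonneg: "0 \<le> ?x$i" "0 \<le> ?y$i" for i
    using near_nonneg[OF G(2)] near_nonneg[OF H(2)] by auto
  have \<epsilon>: "0 \<le> 58 * \<epsilon>" using eps_pos by simp
  have "\<exists>Q. orthogonal_matrix Q \<and> near (6 * \<epsilon>) R Q (abs_mat Q) \<and> fl_mat fp R \<and>
      \<bar>(G ** Q)$1$2\<bar> \<le> 290 * \<epsilon> * N \<and> \<bar>(transpose Q ** H)$1$2\<bar> \<le> 290 * \<epsilon> * N'"
    using rot
  proof
    assume *: "R = rot_to_first fp (G$1$1) (G$1$2) \<and>
        (H$1$2 = 0 \<and> H$2$2 = 0 \<or> (G$1$1 \<noteq> 0 \<or> G$1$2 \<noteq> 0) \<and>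
          (X$1$1 + X$1$2) * (\<bar>H$1$2\<bar> + \<bar>H$2$2\<bar>) \<le> 11/10 * (Y$1$2 + Y$2$2) * (\<bar>G$1$1\<bar> + \<bar>G$1$2\<bar>))"
    obtain Q where Q: "fl_mat fp R" "orthogonal_matrix Q" "near (6 * \<epsilon>) R Q (abs_mat Q)"
      "G$1$1 = norm ?g * Q$1$1" "G$1$2 = norm ?g * Q$2$1" "G$1$1 * Q$1$2 + G$1$2 * Q$2$2 = 0"
      using rot_to_first_near[OF fl_mat_nth[OF G(1)] fl_mat_nth[OF G(1)], of 1 1 1 2] * ng
      by metis
    let ?v = "(transpose Q ** H)$1$2"
    have "\<bar>?v\<bar> \<le> 5 * (58 * \<epsilon>) * norm ?y"
    proof (cases "H$1$2 = 0 \<and> H$2$2 = 0")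
      case True
      then show ?thesis using \<epsilon> by (simp add: matmul_nth)
    next
      case False
      with * have nz: "0 < norm ?g"
        and ratio: "(?x$1 + ?x$2) * (\<bar>?h$1\<bar> + \<bar>?h$2\<bar>) \<le> 11/10 * (?y$1 + ?y$2) * (\<bar>?g$1\<bar> + \<bar>?g$2\<bar>)"
        by (auto simp: zero_less_norm_iff)
      \<comment> \<open>The row of \<open>G\<close> is its norm times the first column of
        \<open>Q\<close>. The inner product therefore contains the factor \<open>norm ?g\<close>,
        which cancels against the same factor in the bound for nearly orthogonal vectors.\<close>
      have "?g \<bullet> ?h = norm ?g * ?v"
        by (simp add: inner_vec_def sum_2 matmul_nth distrib_left flip: mult.assoc Q(4,5))
      with abs_inner_le_of_orthogonal[OF dg dh nonneg orth \<epsilon> ratio]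
      have "norm ?g * \<bar>?v\<bar> \<le> norm ?g * (5 * (58 * \<epsilon>) * norm ?y)"
        by (simp add: abs_mult mult.commute mult.left_commute)
      then show ?thesis using nz by simp
    qed
    also have "\<dots> \<le> 5 * (58 * \<epsilon>) * N'" using H(4)[of 2] \<epsilon> by (intro mult_left_mono) auto
    finally show ?thesis using Q N0 eps_pos by (intro exI[of _ Q]) (simp add: matmul_nth)
  next
    assume *: "R = rot_to_second fp (H$1$2) (H$2$2) \<and>
        (G$1$1 = 0 \<and> G$1$2 = 0 \<or> (H$1$2 \<noteq> 0 \<or> H$2$2 \<noteq> 0) \<and>
          (Y$1$2 + Y$2$2) * (\<bar>G$1$1\<bar> + \<bar>G$1$2\<bar>) \<le> 11/10 * (X$1$1 + X$1$2) * (\<bar>H$1$2\<bar> + \<bar>H$2$2\<bar>))"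
    obtain Q where Q: "fl_mat fp R" "orthogonal_matrix Q" "near (6 * \<epsilon>) R Q (abs_mat Q)"
      "H$1$2 = norm ?h * Q$1$2" "H$2$2 = norm ?h * Q$2$2" "H$1$2 * Q$1$1 + H$2$2 * Q$2$1 = 0"
      using rot_to_second_near[OF fl_mat_nth[OF H(1)] fl_mat_nth[OF H(1)], of 1 2 2 2] * nh
      by metis
    let ?v = "(G ** Q)$1$2"
    have "\<bar>?v\<bar> \<le> 5 * (58 * \<epsilon>) * norm ?x"
    proof (cases "G$1$1 = 0 \<and> G$1$2 = 0")
      case True
      then show ?thesis using \<epsilon> by (simp add: matmul_nth)
    next
      case False
      with * have nz: "0 < norm ?h"
        and ratio: "(?y$1 + ?y$2) * (\<bar>?g$1\<bar> + \<bar>?g$2\<bar>) \<le> 11/10 * (?x$1 + ?x$2) * (\<bar>?h$1\<bar> + \<bar>?h$2\<bar>)"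
        by (auto simp: nh add_pos_nonneg add_nonneg_pos)
      have "?h \<bullet> ?g = norm ?h * Q$1$2 * G$1$1 + norm ?h * Q$2$2 * G$1$2"
        by (simp add: inner_vec_def sum_2 flip: Q(4,5))
      then have "?h \<bullet> ?g = norm ?h * ?v"
        by (simp add: matmul_nth distrib_left mult.commute mult.left_commute)
      with abs_inner_le_of_orthogonal[OF dh dg nonneg(2,1) _ \<epsilon> ratio] orth
      have "norm ?h * \<bar>?v\<bar> \<le> norm ?h * (5 * (58 * \<epsilon>) * norm ?x)"
        by (simp add: abs_mult mult.commute mult.left_commute inner_commute)
      then show ?thesis using nz by simp
    qed
    also have "\<dots> \<le> 5 * (58 * \<epsilon>) * N" using G(4)[of 1] \<epsilon> by (intro mult_left_mono) auto
    finally show ?thesis using Q N0 eps_pos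
      by (intro exI[of _ Q]) (simp add: matmul_nth mult.commute)
  qed
  then obtain Q where Q: "orthogonal_matrix Q" "near (6 * \<epsilon>) R Q (abs_mat Q)" "fl_mat fp R"
      "\<bar>(G ** Q)$1$2\<bar> \<le> 290 * \<epsilon> * N" "\<bar>(transpose Q ** H)$1$2\<bar> \<le> 290 * \<epsilon> * N'"
    by blast
  let ?G' = "fl_matmul fp G R" and ?H' = "fl_matmul fp (transpose R) H"
  note H_transpose = near_transpose[OF H(2)] H(4)
  note P = fl_matmul_close[OF G(1) Q(3)]
  note P' = fl_matmul_transpose_close[OF Q(3) H(1)]
  have "(transpose H ** Q)$2$1 = (transpose Q ** H)$1$2" by (simp add: matmul_nth mult.commute)
  with rotated_zero_entry_bound[OF Q(1,2) P' H_transpose, of 2 1] Q(5)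
  have "spec_norm (transpose (zero_entry 1 2 ?H' - transpose Q ** H\<^sub>0)) \<le> 480 * \<epsilon> * N'"
    by (simp only: transpose_zero_entry transpose_diff matrix_transpose_mul transpose_transpose)
  then have "spec_norm (zero_entry 1 2 ?H' - transpose Q ** H\<^sub>0) \<le> 480 * \<epsilon> * N'" by simp
  moreover note rotated_zero_entry_bound[OF Q(1,2) P G(2,4) Q(4)]
  moreover have "\<exists>e f. norm e \<le> 80 * \<epsilon> * N \<and> norm f \<le> 80 * \<epsilon> * N' \<and>
     (zero_entry 1 2 ?G'$2 + e) \<bullet> (transpose (zero_entry 1 2 ?H') $ 1 + f) = 0"
  proof (intro exI conjI)
    \<comment> \<open>The perturbations replace the row and the column by those of the exactly
      rotated factors of \<open>M\<close>. The rotation then cancels, and the inner product is the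
      (2,1) entry of a diagonal matrix. The entries set to zero lie outside this row and this
      column.\<close>
    let ?e = "(G\<^sub>1 ** Q - ?G')$2" and ?f = "(transpose H\<^sub>1 ** Q - transpose ?H')$1"
    show "norm ?e \<le> 80 * \<epsilon> * N"
      using rotated_row_bound[OF Q(1,2) P G(2,4,3), of 2] by (simp add: norm_minus_commute)
    show "norm ?f \<le> 80 * \<epsilon> * N'"
      using rotated_row_bound[OF Q(1,2) P' H_transpose close_transpose[OF H(3)], of 1]
      by (simp add: norm_minus_commute)
    have "zero_entry 1 2 ?G'$2 + ?e = (G\<^sub>1 ** Q)$2"
      "transpose (zero_entry 1 2 ?H')$1 + ?f = (transpose H\<^sub>1 ** Q)$1"
      by (simp_all add: vec_eq_iff zero_entry_nth)
    moreover have "(G\<^sub>1 ** Q)$2 \<bullet> (transpose H\<^sub>1 ** Q)$1 = (G\<^sub>1 ** Q ** transpose (transpose H\<^sub>1 ** Q))$2$1"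
      by (simp add: inner_vec_def sum_2 matmul_nth[of "G\<^sub>1 ** Q"])
    moreover have "G\<^sub>1 ** Q ** transpose (transpose H\<^sub>1 ** Q) = G\<^sub>1 ** (Q ** transpose Q) ** H\<^sub>1"
      by (simp only: matrix_transpose_mul transpose_transpose matrix_mul_assoc)
    moreover have "Q ** transpose Q = mat 1" using Q(1) by (simp add: orthogonal_matrix_def)
    ultimately show "(zero_entry 1 2 ?G'$2 + ?e) \<bullet> (transpose (zero_entry 1 2 ?H') $ 1 + ?f) = 0"
      using diag by (simp add: diagonal2_def)
  qed
  ultimately show ?thesis
    unfolding stable_pair_def using Q(1) by (auto simp: lower_tri_def zero_entry_nth)
qed

end

lemma abs_mat_transpose: "abs_mat (transpose X) = transpose (abs_mat X)"
  by (simp add: vec_eq_iff)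

section \<open>Parallel rows and columns, backward errors\<close>

lemma collinear_real2I:
  fixes x y :: "real^2"
  assumes "x$1 * y$2 = x$2 * y$1"
  shows "collinear {0, x, y}"
proof (cases "x = 0")
  case False
  then consider "x$1 \<noteq> 0" | "x$2 \<noteq> 0" by (auto simp: vec_eq_iff forall_2)
  then have "\<exists>c. y = c *\<^sub>R x"
  proof cases
    case 1
    with assms show ?thesis
      by (intro exI[of _ "y$1 / x$1"]) (simp add: vec_eq_iff forall_2 field_simps)
  next
    case 2
    with assms show ?thesis
      by (intro exI[of _ "y$2 / x$2"]) (simp add: vec_eq_iff forall_2 field_simps)
  qed
  then show ?thesis by (simp add: collinear_lemma)
qed (simp add: collinear_lemma)

lemma spec_norm_mat2_row2:
  fixes e :: "real^2"
  shows "spec_norm (mat2 0 0 (e$1) (e$2)) \<le> norm e"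
proof -
  have "mat2 0 0 (e$1) (e$2) $ 1 = 0" "mat2 0 0 (e$1) (e$2) $ 2 = e"
    by (simp_all add: vec_eq_iff forall_2)
  then show ?thesis using spec_norm_le_rows[of "mat2 0 0 (e$1) (e$2)"] by simp
qed

text \<open>These are the shapes in which the perturbations of a pair reappear after taking
  adjugates: a change \<open>f\<close> of the first column of H' is a change of the second row of
  adj(H'), and a change \<open>e\<close> of the second row of G' is a change of the first column of
  adj(G').\<close>

lemma spec_norm_mat2_perp:
  fixes e f :: "real^2"
  shows "spec_norm (mat2 0 0 (- (f$2)) (f$1)) \<le> norm f"
    and "spec_norm (mat2 (e$2) 0 (- (e$1)) 0) \<le> norm e"
    and "spec_norm (mat2 (e$1) 0 (e$2) 0) \<le> norm e"
proof -
  have *: "spec_norm (mat2 0 0 (- (f$2)) (f$1)) \<le> norm f" for f :: "real^2"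
    using spec_norm_mat2_row2[of "vector [- (f$2), f$1]"] by (simp add: norm_real2 add.commute)
  show "spec_norm (mat2 0 0 (- (f$2)) (f$1)) \<le> norm f" by (rule *)
  have "mat2 (e$2) 0 (- (e$1)) 0 = adj2 (mat2 0 0 (e$1) (e$2))" by (simp add: rmat2_eq_iff)
  then show "spec_norm (mat2 (e$2) 0 (- (e$1)) 0) \<le> norm e"
    using spec_norm_mat2_row2[of e] by simp
  have "mat2 (e$1) 0 (e$2) 0 = adj2 (mat2 0 0 (- (e$2)) (e$1))" by (simp add: rmat2_eq_iff)
  then show "spec_norm (mat2 (e$1) 0 (e$2) 0) \<le> norm e"
    using * by simp
qed

text \<open>Undoing the two orthogonal factors turns the forward error into a backward error without
  increasing its norm.\<close>

lemma orthogonal_perturbation: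
  assumes P: "orthogonal_matrix P" and Q: "orthogonal_matrix Q"
    and D: "spec_norm (X' - transpose P ** X ** Q) \<le> d"
  obtains \<delta> where "X' = transpose P ** (X + \<delta>) ** Q" "spec_norm \<delta> \<le> d"
proof
  let ?D = "X' - transpose P ** X ** Q"
  have id: "transpose P ** P = mat 1" "transpose Q ** Q = mat 1"
    using P Q by (simp_all add: orthogonal_matrix)
  have "transpose P ** (P ** ?D ** transpose Q) ** Q = (transpose P ** P) ** ?D ** (transpose Q ** Q)"
    by (simp only: matrix_mul_assoc)
  also have "\<dots> = ?D" by (simp add: id)
  finally show "X' = transpose P ** (X + P ** ?D ** transpose Q) ** Q"
    by (simp add: rmat2_eq_iff matmul_nth algebra_simps)
  show "spec_norm (P ** ?D ** transpose Q) \<le> d"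
    using spec_norm_orthogonal_mult[of P "transpose Q" ?D] P Q D by simp
qed

context fp_model
begin

lemma stable_pair_rows:
  assumes "stable_pair G\<^sub>0 H\<^sub>0 N N' G' H'" "80 * \<epsilon> * N \<le> \<alpha>" "80 * \<epsilon> * N' \<le> \<beta>"
  shows "rows_within_of_parallel \<alpha> \<beta> G' (adj2 H')"
proof -
  obtain e f where ef: "norm e \<le> 80 * \<epsilon> * N" "norm f \<le> 80 * \<epsilon> * N'"
      "(G'$2 + e) \<bullet> (transpose H' $ 1 + f) = 0" and tri: "G'$1$2 = 0" "H'$1$2 = 0"
    using assms(1) by (auto simp: stable_pair_def lower_tri_def)
  let ?E = "mat2 0 0 (e$1) (e$2)" and ?F = "mat2 0 0 (- (f$2)) (f$1)"
  have "collinear {0, row i (G' + ?E), row i (adj2 H' + ?F)}" for i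
    using exhaust_2[of i] ef(3) tri
    by (intro collinear_real2I) (auto simp: row_def inner_vec_def sum_2 algebra_simps)
  then show ?thesis
    unfolding rows_within_of_parallel_def
    using spec_norm_mat2_row2[of e] spec_norm_mat2_perp(1)[of f] ef(1,2) assms(2,3)
    by (intro exI[of _ ?E] exI[of _ ?F]) (auto intro: order_trans)
qed

text \<open>The orthogonality relation is the same as for rows: the first column of adj(G') is the
  second row of G' turned by a right angle. The second columns are both multiples of the second unit
  vector.\<close>

lemma stable_pair_columns:
  assumes "stable_pair G\<^sub>0 H\<^sub>0 N N' G' H'" "80 * \<epsilon> * N \<le> \<alpha>" "80 * \<epsilon> * N' \<le> \<beta>"
  shows "columns_within_of_parallel \<alpha> \<beta> (adj2 G') H'"
proof -
  obtain e f where ef: "norm e \<le> 80 * \<epsilon> * N" "norm f \<le> 80 * \<epsilon> * N'"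
      "(G'$2 + e) \<bullet> (transpose H' $ 1 + f) = 0" and tri: "G'$1$2 = 0" "H'$1$2 = 0"
    using assms(1) by (auto simp: stable_pair_def lower_tri_def)
  let ?E = "mat2 (e$2) 0 (- (e$1)) 0" and ?F = "mat2 (f$1) 0 (f$2) 0"
  have "collinear {0, column j (adj2 G' + ?E), column j (H' + ?F)}" for j
    using exhaust_2[of j] ef(3) tri
    by (intro collinear_real2I) (auto simp: column_def inner_vec_def sum_2 algebra_simps)
  then show ?thesis
    unfolding columns_within_of_parallel_def
    using spec_norm_mat2_perp(2)[of e] spec_norm_mat2_perp(3)[of f] ef(1,2) assms(2,3)
    by (intro exI[of _ ?E] exI[of _ ?F]) (auto intro: order_trans)
qed

section \<open>Backward error of the computed product \<open>M\<close>\<close>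

lemma rounding_product_le:
  assumes "\<bar>a\<bar> \<le> \<epsilon>" "\<bar>b\<bar> \<le> \<epsilon>" "\<bar>c\<bar> \<le> \<epsilon>" "\<bar>d\<bar> \<le> \<epsilon>"
  shows "\<bar>(1 + a) * (1 + b) * (1 + c) * (1 + d) - 1\<bar> \<le> 5 * \<epsilon>"
proof -
  have step: "\<bar>(1 + x) * (1 + y) - 1\<bar> \<le> (k + 11/10) * \<epsilon>"
    if "\<bar>x\<bar> \<le> k * \<epsilon>" "\<bar>y\<bar> \<le> \<epsilon>" "0 \<le> k" "k \<le> 5" for x y k :: real
  proof -
    have "\<bar>x\<bar> * \<bar>y\<bar> \<le> (k * \<epsilon>) * \<epsilon>" using that by (intro mult_mono) auto
    also have "\<dots> \<le> 5 * (\<epsilon> * \<epsilon>)" unfolding mult.assoc using that by (intro mult_right_mono) auto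
    also have "\<dots> \<le> 1/10 * \<epsilon>" using eps_sq eps_pos by simp
    finally have "\<bar>x * y\<bar> \<le> 1/10 * \<epsilon>" by (simp add: abs_mult)
    moreover have "(1 + x) * (1 + y) - 1 = x + y + x * y" by (simp add: algebra_simps)
    moreover have "(k + 11/10) * \<epsilon> = k * \<epsilon> + 11/10 * \<epsilon>" by (simp add: distrib_right)
    ultimately show ?thesis using that by linarith
  qed
  have 2: "\<bar>(1 + a) * (1 + b) - 1\<bar> \<le> (21/10) * \<epsilon>" using step[of a 1 b] assms by simp
  have 3: "\<bar>(1 + a) * (1 + b) * (1 + c) - 1\<bar> \<le> (32/10) * \<epsilon>"
    using step[OF 2 assms(3)] by simp
  have "\<bar>(1 + a) * (1 + b) * (1 + c) * (1 + d) - 1\<bar> \<le> (43/10) * \<epsilon>"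
    using step[OF 3 assms(4)] by simp
  then show ?thesis using eps_pos by simp
qed

text \<open>A rounding multiplies all monomials that it acts on, and no monomial passes through more
  than four roundings. The bound 5 is this four plus room for higher-order terms.\<close>

lemma computed_M_entries:
  assumes fl: "fl_mat fp A" "fl_mat fp B" "fl_mat fp C"
  obtains t1 t2 t3 t4 t5 where
    "\<bar>t1 - 1\<bar> \<le> 5 * \<epsilon>" "\<bar>t2 - 1\<bar> \<le> 5 * \<epsilon>" "\<bar>t3 - 1\<bar> \<le> 5 * \<epsilon>" "\<bar>t4 - 1\<bar> \<le> 5 * \<epsilon>" "\<bar>t5 - 1\<bar> \<le> 5 * \<epsilon>"
    "computed_M fp A B C = mat2 (C$1$1 * A$2$2 * B$1$1 * t4)
      (C$1$1 * A$2$2 * B$1$2 * t1 + C$1$2 * A$1$1 * B$2$2 * t2 - C$1$1 * A$1$2 * B$2$2 * t3)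
      0 (C$2$2 * A$1$1 * B$2$2 * t5)"
proof -
  note nA = fl_mat_nth[OF fl(1)] and nB = fl_mat_nth[OF fl(2)] and nC = fl_mat_nth[OF fl(3)]
  note n = nA nB nC fl_nums_ops
  have mul: "\<exists>e. \<bar>e\<bar> \<le> \<epsilon> \<and> fl_mul fp x y = x * y * (1 + e)"
    and add: "\<exists>e. \<bar>e\<bar> \<le> \<epsilon> \<and> fl_add fp x y = (x + y) * (1 + e)"
    and sub: "\<exists>e. \<bar>e\<bar> \<le> \<epsilon> \<and> fl_sub fp x y = (x - y) * (1 + e)"
    if "x \<in> fl_nums fp" "y \<in> fl_nums fp" for x y
    using rel_approx_ops[OF that] unfolding rel_approx_def by blast+
  define p where "p = fl_mul fp (C$1$1) (A$2$2)"
  define q where "q = fl_mul fp (A$1$1) (B$2$2)"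
  define r where "r = fl_mul fp (C$1$1) (A$1$2)"
  have pqr: "p \<in> fl_nums fp" "q \<in> fl_nums fp" "r \<in> fl_nums fp" by (simp_all add: p_def q_def r_def n)
  obtain e1 where e1: "\<bar>e1\<bar> \<le> \<epsilon>" "p = C$1$1 * A$2$2 * (1 + e1)"
    unfolding p_def using mul[OF nC nA] by blast
  obtain e3 where e3: "\<bar>e3\<bar> \<le> \<epsilon>" "q = A$1$1 * B$2$2 * (1 + e3)"
    unfolding q_def using mul[OF nA nB] by blast
  obtain e9 where e9: "\<bar>e9\<bar> \<le> \<epsilon>" "r = C$1$1 * A$1$2 * (1 + e9)"
    unfolding r_def using mul[OF nC nA] by blast
  obtain e2 where e2: "\<bar>e2\<bar> \<le> \<epsilon>" "fl_mul fp p (B$1$1) = p * B$1$1 * (1 + e2)"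
    using mul[OF pqr(1) nB] by blast
  obtain e4 where e4: "\<bar>e4\<bar> \<le> \<epsilon>" "fl_mul fp (C$2$2) q = C$2$2 * q * (1 + e4)"
    using mul[OF nC pqr(2)] by blast
  define x where "x = fl_mul fp p (B$1$2)"
  define y where "y = fl_mul fp (C$1$2) q"
  define z where "z = fl_mul fp r (B$2$2)"
  define w where "w = fl_add fp x y"
  have xyz: "x \<in> fl_nums fp" "y \<in> fl_nums fp" "z \<in> fl_nums fp" "w \<in> fl_nums fp"
    by (simp_all add: x_def y_def z_def w_def n pqr)
  obtain e5 where e5: "\<bar>e5\<bar> \<le> \<epsilon>" "x = p * B$1$2 * (1 + e5)"
    unfolding x_def using mul[OF pqr(1) nB] by blast
  obtain e8 where e8: "\<bar>e8\<bar> \<le> \<epsilon>" "y = C$1$2 * q * (1 + e8)"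
    unfolding y_def using mul[OF nC pqr(2)] by blast
  obtain e10 where e10: "\<bar>e10\<bar> \<le> \<epsilon>" "z = r * B$2$2 * (1 + e10)"
    unfolding z_def using mul[OF pqr(3) nB] by blast
  obtain e6 where e6: "\<bar>e6\<bar> \<le> \<epsilon>" "w = (x + y) * (1 + e6)"
    unfolding w_def using add[OF xyz(1,2)] by blast
  obtain e7 where e7: "\<bar>e7\<bar> \<le> \<epsilon>" "fl_sub fp w z = (w - z) * (1 + e7)"
    using sub[OF xyz(4,3)] by blast
  note e = e1(1) e2(1) e3(1) e4(1) e5(1) e6(1) e7(1) e8(1) e9(1) e10(1)
  have zero: "\<bar>0::real\<bar> \<le> \<epsilon>" using eps_pos by simp
  have "computed_M fp A B C = mat2 (fl_mul fp p (B$1$1)) (fl_sub fp w z) 0 (fl_mul fp (C$2$2) q)"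
    by (simp add: computed_M_def p_def q_def r_def x_def y_def z_def w_def)
  \<comment> \<open>Factors \<open>1 + 0\<close> pad the shorter products, so that one bound for
    four factors covers all five monomials.\<close>
  also have "\<dots> = mat2 (C$1$1 * A$2$2 * B$1$1 * ((1 + e1) * (1 + e2) * (1 + 0) * (1 + 0)))
      (C$1$1 * A$2$2 * B$1$2 * ((1 + e1) * (1 + e5) * (1 + e6) * (1 + e7)) +
       C$1$2 * A$1$1 * B$2$2 * ((1 + e3) * (1 + e8) * (1 + e6) * (1 + e7)) -
       C$1$1 * A$1$2 * B$2$2 * ((1 + e9) * (1 + e10) * (1 + e7) * (1 + 0)))
      0 (C$2$2 * A$1$1 * B$2$2 * ((1 + e3) * (1 + e4) * (1 + 0) * (1 + 0)))"
    unfolding e2(2) e4(2) e7(2) unfolding e6(2) unfolding e5(2) e8(2) e10(2)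
    unfolding e1(2) e3(2) e9(2)
    by (intro arg_cong4[where f = mat2]) (simp_all add: algebra_simps)
  finally show thesis
    by (rule that[OF rounding_product_le[OF e(1,5,6,7)] rounding_product_le[OF e(3,8,6,7)]
          rounding_product_le[OF e(9,10,7) zero] rounding_product_le[OF e(1,2) zero zero]
          rounding_product_le[OF e(3,4) zero zero]])
qed

text \<open>\<open>M\<close> consists of five monomials with five separate rounding factors, and
  each factor can be absorbed by an entry that no other monomial uses. The entries
  \<open>c12\<close> and \<open>c22\<close> of \<open>C\<close> take \<open>t2\<close> and
  \<open>t5\<close>, and the terms of adj(A) B take the others; symmetrically, \<open>b11\<close>
  and \<open>b12\<close> take \<open>t4\<close> and \<open>t1\<close>, and the terms of C adj(A)
  take the rest. Entries shared by several monomials stay unchanged. These exact values are recorded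
  because the optional assignments rely on exact zeros.\<close>

lemma computed_M_factorization:
  assumes fl: "fl_mat fp A" "fl_mat fp B" "fl_mat fp C" and tri: "upper_tri A" "upper_tri B" "upper_tri C"
  obtains C\<^sub>1 H\<^sub>1 K\<^sub>1 B\<^sub>1 where "computed_M fp A B C = C\<^sub>1 ** H\<^sub>1" "computed_M fp A B C = K\<^sub>1 ** B\<^sub>1"
    "close (5 * \<epsilon>) C\<^sub>1 C (abs_mat C)" "close (5 * \<epsilon>) H\<^sub>1 (adj2 A ** B) (abs_mat (adj2 A) ** abs_mat B)"
    "close (5 * \<epsilon>) K\<^sub>1 (C ** adj2 A) (abs_mat C ** abs_mat (adj2 A))" "close (5 * \<epsilon>) B\<^sub>1 B (abs_mat B)"
    "C\<^sub>1$1$1 = C$1$1" "C\<^sub>1$2$1 = 0" "H\<^sub>1$2$2 = A$1$1 * B$2$2"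
    "B\<^sub>1$2$2 = B$2$2" "B\<^sub>1$2$1 = 0" "K\<^sub>1$1$1 = C$1$1 * A$2$2"
    "(computed_M fp A B C)$1$1 = K\<^sub>1$1$1 * B\<^sub>1$1$1"
    "(computed_M fp A B C)$2$2 = C\<^sub>1$2$2 * H\<^sub>1$2$2"
proof -
  obtain t1 t2 t3 t4 t5 where
    t: "\<bar>t1 - 1\<bar> \<le> 5 * \<epsilon>" "\<bar>t2 - 1\<bar> \<le> 5 * \<epsilon>" "\<bar>t3 - 1\<bar> \<le> 5 * \<epsilon>" "\<bar>t4 - 1\<bar> \<le> 5 * \<epsilon>" "\<bar>t5 - 1\<bar> \<le> 5 * \<epsilon>" and
    M: "computed_M fp A B C = mat2 (C$1$1 * A$2$2 * B$1$1 * t4)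
      (C$1$1 * A$2$2 * B$1$2 * t1 + C$1$2 * A$1$1 * B$2$2 * t2 - C$1$1 * A$1$2 * B$2$2 * t3)
      0 (C$2$2 * A$1$1 * B$2$2 * t5)"
    by (rule computed_M_entries[OF fl])
  have z: "A$2$1 = 0" "B$2$1 = 0" "C$2$1 = 0" using tri by (auto simp: upper_tri_def)
  have b: "\<bar>x * t - x\<bar> \<le> 5 * \<epsilon> * \<bar>x\<bar>" if "\<bar>t - 1\<bar> \<le> 5 * \<epsilon>" for x t
  proof -
    have "\<bar>x * t - x\<bar> = \<bar>t - 1\<bar> * \<bar>x\<bar>" by (simp add: algebra_simps flip: abs_mult)
    also have "\<dots> \<le> 5 * \<epsilon> * \<bar>x\<bar>" using that by (intro mult_right_mono) auto
    finally show ?thesis .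
  qed
  have b2: "\<bar>(x * t + y * u) - (x + y)\<bar> \<le> 5 * \<epsilon> * (\<bar>x\<bar> + \<bar>y\<bar>)"
    if "\<bar>t - 1\<bar> \<le> 5 * \<epsilon>" "\<bar>u - 1\<bar> \<le> 5 * \<epsilon>" for x t y u
    using b[OF that(1), of x] b[OF that(2), of y] unfolding distrib_left by linarith
  define C1 where "C1 = mat2 (C$1$1) (C$1$2 * t2) 0 (C$2$2 * t5)"
  define H1 where "H1 = mat2 (A$2$2 * B$1$1 * t4) (A$2$2 * B$1$2 * t1 + - (A$1$2 * B$2$2) * t3) 0 (A$1$1 * B$2$2)"
  define K1 where "K1 = mat2 (C$1$1 * A$2$2) (- (C$1$1 * A$1$2) * t3 + C$1$2 * A$1$1 * t2) 0 (C$2$2 * A$1$1 * t5)"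
  define B1 where "B1 = mat2 (B$1$1 * t4) (B$1$2 * t1) 0 (B$2$2)"
  show thesis
  proof (rule that[of C1 H1 K1 B1])
    show "computed_M fp A B C = C1 ** H1" "computed_M fp A B C = K1 ** B1"
      by (simp_all add: M rmat2_eq_iff matmul_nth C1_def H1_def K1_def B1_def algebra_simps)
    show "close (5 * \<epsilon>) C1 C (abs_mat C)" "close (5 * \<epsilon>) B1 B (abs_mat B)"
      using t eps_pos by (simp_all add: close_def forall_2 C1_def B1_def z b)
    show "close (5 * \<epsilon>) H1 (adj2 A ** B) (abs_mat (adj2 A) ** abs_mat B)"
      using t eps_pos b[OF t(4), of "A$2$2 * B$1$1"] b2[OF t(1,3), of "A$2$2 * B$1$2" "- (A$1$2 * B$2$2)"]
      by (simp add: close_def forall_2 H1_def z matmul_nth abs_mult)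
    show "close (5 * \<epsilon>) K1 (C ** adj2 A) (abs_mat C ** abs_mat (adj2 A))"
      using t eps_pos b[OF t(5), of "C$2$2 * A$1$1"] b2[OF t(3,2), of "- (C$1$1 * A$1$2)" "C$1$2 * A$1$1"]
      by (simp add: close_def forall_2 K1_def z matmul_nth abs_mult)
  qed (simp_all add: M C1_def H1_def K1_def B1_def)
qed

end

section \<open>The computed singular value decomposition and the algorithm\<close>

lemma norm_matrix_le_rows:
  fixes X :: rmat2 assumes "\<And>i. norm (X$i) \<le> b" shows "norm X \<le> sqrt 2 * b"
proof -
  have "0 \<le> b" using assms order_trans[OF norm_ge_zero] by blast
  have "(norm (X$1))\<^sup>2 + (norm (X$2))\<^sup>2 \<le> b\<^sup>2 + b\<^sup>2"
    using assms by (intro add_mono power_mono) auto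
  then have "sqrt ((norm (X$1))\<^sup>2 + (norm (X$2))\<^sup>2) \<le> sqrt (2 * b\<^sup>2)" by simp
  then show ?thesis
    using \<open>0 \<le> b\<close> by (simp add: norm_vec_def[of X] L2_set_def sum_2 real_sqrt_mult)
qed

lemma spec_norm_minus: "spec_norm (- X) = spec_norm X"
proof -
  have "(*v) (- X) = (\<lambda>x. - (X *v x))" by (simp add: fun_eq_iff vec_eq_iff matvec_nth)
  then show ?thesis unfolding spec_norm_def by (simp only: onorm_neg)
qed

lemma norm_abs_mat_row [simp]: "norm (abs_mat X $ i) = norm (X $ i)"
  by (simp add: norm_real2)

lemma norm_row_matmul_le_mult:
  fixes X Y :: rmat2
  assumes "norm (X$i) \<le> a" "spec_norm Y \<le> b"
  shows "norm ((X ** Y)$i) \<le> a * b"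
  using norm_row_matmul_le[of X Y i] mult_mono[OF assms order_trans[OF norm_ge_zero assms(1)]]
  by simp

context fp_model
begin

text \<open>Each row of an orthogonal matrix has norm 1, so the error of \<open>U\<close> or
  \<open>V\<close> has Frobenius norm at most sqrt 2 * 93/2, which is below 329/5 = 65.8. The two
  errors together give 131.6, and the remaining 0.4 absorbs their product.\<close>

lemma within_of_diagonal_svd:
  assumes svd: "unnormalized_svd M U\<^sub>0 V\<^sub>0"
    and U: "near (93/2 * \<epsilon>) U U\<^sub>0 (abs_mat U\<^sub>0)" and V: "near (93/2 * \<epsilon>) V V\<^sub>0 (abs_mat V\<^sub>0)"
  shows "within_of_diagonal (132 * \<epsilon> * spec_norm M) (transpose V ** M ** U)"
proof -
  have orth: "orthogonal_matrix U\<^sub>0" "orthogonal_matrix V\<^sub>0"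
    using svd by (auto simp: unnormalized_svd_def)
  have d: "spec_norm (X\<^sub>0 - X) \<le> 329/5 * \<epsilon>"
    if "near (93/2 * \<epsilon>) X X\<^sub>0 (abs_mat X\<^sub>0)" "orthogonal_matrix X\<^sub>0" for X X\<^sub>0
  proof -
    have "norm ((X\<^sub>0 - X)$i) \<le> 93/2 * \<epsilon> * 1" for i
      using close_row[OF close_sym[OF near_close[OF that(1)]], of i 1] eps_pos norm_orthogonal_row[OF that(2)]
      by simp
    then have "spec_norm (X\<^sub>0 - X) \<le> sqrt 2 * (93/2 * \<epsilon> * 1)"
      using spec_norm_le_norm norm_matrix_le_rows order_trans by blast
    also have "sqrt 2 \<le> 1415/1000" by (rule real_le_lsqrt) (auto simp: power2_eq_square)
    finally show ?thesis using eps_pos by simp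
  qed
  let ?m = "spec_norm M" and ?\<eta> = "329/5 * \<epsilon>"
  have prod: "spec_norm (X ** M ** Y) \<le> x * ?m * y"
    if "spec_norm X \<le> x" "spec_norm Y \<le> y" for X Y x y
  proof -
    have "spec_norm (X ** M ** Y) \<le> spec_norm X * ?m * spec_norm Y"
      by (meson spec_norm_mult mult_right_mono order_trans spec_norm_nonneg)
    also have "\<dots> \<le> x * ?m * y"
      using that order_trans[OF spec_norm_nonneg that(1)] by (intro mult_mono) auto
    finally show ?thesis .
  qed
  have V1: "spec_norm (transpose V) \<le> 1 + ?\<eta>"
  proof -
    have "V = V\<^sub>0 + - (V\<^sub>0 - V)" by simp
    then have "spec_norm V \<le> spec_norm V\<^sub>0 + spec_norm (- (V\<^sub>0 - V))" by (metis spec_norm_add)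
    also have "spec_norm (- (V\<^sub>0 - V)) = spec_norm (V\<^sub>0 - V)"
      by (rule spec_norm_minus)
    finally show ?thesis using d[OF V orth(2)] spec_norm_orthogonal[OF orth(2)] by simp
  qed
  let ?E = "transpose V\<^sub>0 ** M ** U\<^sub>0 - transpose V ** M ** U"
  have "?E = transpose (V\<^sub>0 - V) ** M ** U\<^sub>0 + transpose V ** M ** (U\<^sub>0 - U)"
    by (simp add: rmat2_eq_iff matmul_nth algebra_simps)
  then have "spec_norm ?E \<le> spec_norm (transpose (V\<^sub>0 - V) ** M ** U\<^sub>0) + spec_norm (transpose V ** M ** (U\<^sub>0 - U))"
    by (metis spec_norm_add)
  also have "\<dots> \<le> ?\<eta> * ?m * 1 + (1 + ?\<eta>) * ?m * ?\<eta>"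
    using d[OF V orth(2)] d[OF U orth(1)] V1 spec_norm_orthogonal[OF orth(1)]
    by (intro add_mono prod) simp_all
  also have "\<dots> = (658/5 * \<epsilon> + 108241/25 * (\<epsilon> * \<epsilon>)) * ?m" by (simp add: algebra_simps)
  also have "\<dots> \<le> 132 * \<epsilon> * ?m"
  proof (rule mult_right_mono)
    have "\<epsilon> * \<epsilon> \<le> \<epsilon> / 1000000" using eps_sq by simp
    then show "658/5 * \<epsilon> + 108241/25 * (\<epsilon> * \<epsilon>) \<le> 132 * \<epsilon>" using eps_pos by argo
  qed simp
  finally have "spec_norm ?E \<le> 132 * \<epsilon> * ?m" .
  moreover have "diagonal2 (transpose V ** M ** U + ?E)" using svd by (simp add: unnormalized_svd_def)
  ultimately show ?thesis unfolding within_of_diagonal_def by blast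
qed

text \<open>If \<open>c11\<close> or \<open>b22\<close> is zero, then \<open>M\<close> is singular,
  and by the ordering the vanishing diagonal entry is the second one. Multiplication by
  \<open>J2\<close> swaps the diagonal entries, but it happens only when both \<open>c11\<close> and
  \<open>b22\<close> are nonzero, where the last claim is vacuous.\<close>

lemma computed_UV_svd:
  assumes fl: "fl_mat fp A" "fl_mat fp B" "fl_mat fp C"
    and tri: "upper_tri A" "upper_tri B" "upper_tri C"
    and svd: "xlasv2_model \<epsilon> ordered fp" and UV: "computed_UV fp A B C = (U, V)"
  obtains U\<^sub>0 V\<^sub>0 where "fl_mat fp U" "fl_mat fp V" "unnormalized_svd (computed_M fp A B C) U\<^sub>0 V\<^sub>0"
    "near (93/2 * \<epsilon>) U U\<^sub>0 (abs_mat U\<^sub>0)" "near (93/2 * \<epsilon>) V V\<^sub>0 (abs_mat V\<^sub>0)"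
    "ordered \<and> (C$1$1 = 0 \<or> B$2$2 = 0) \<longrightarrow> (transpose V\<^sub>0 ** computed_M fp A B C ** U\<^sub>0)$2$2 = 0"
proof -
  define M where "M = computed_M fp A B C"
  obtain U1 V1 where UV1: "xlasv2 fp M = (U1, V1)" by fastforce
  obtain C\<^sub>1 H\<^sub>1 K\<^sub>1 B\<^sub>1 :: rmat2 where M: "H\<^sub>1$2$2 = A$1$1 * B$2$2" "K\<^sub>1$1$1 = C$1$1 * A$2$2"
    "M$1$1 = K\<^sub>1$1$1 * B\<^sub>1$1$1" "M$2$2 = C\<^sub>1$2$2 * H\<^sub>1$2$2"
    unfolding M_def by (rule computed_M_factorization[OF fl tri])
  have M21: "M$2$1 = 0" by (simp add: M_def computed_M_def)
  have "fl_mat fp M"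
    unfolding M_def computed_M_def fl_mat_def forall_2 mat2_nth
    by (intro conjI fl_nums_ops fl_nums_const fl_mat_nth fl)
  then obtain U0 V0 where 1: "fl_mat fp U1" "fl_mat fp V1" "unnormalized_svd M U0 V0"
    "ordered \<Longrightarrow> \<bar>(transpose V0 ** M ** U0)$1$1\<bar> \<ge> \<bar>(transpose V0 ** M ** U0)$2$2\<bar>"
    "\<And>i j. rel_approx (46.5 * \<epsilon>) (U0$i$j) (U1$i$j)" "\<And>i j. rel_approx (46.5 * \<epsilon>) (V0$i$j) (V1$i$j)"
    using svd UV1 M21 unfolding xlasv2_model_def upper_tri_def by metis
  have near1: "near (93/2 * \<epsilon>) U1 U0 (abs_mat U0)" "near (93/2 * \<epsilon>) V1 V0 (abs_mat V0)"
    using rel_approxD[OF 1(5)] rel_approxD[OF 1(6)] by (auto simp: near_def close_def)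
  show thesis
  proof (cases "(U, V) = (U1, V1)")
    case True
    have "(transpose V0 ** M ** U0)$2$2 = 0" if "ordered" "C$1$1 = 0 \<or> B$2$2 = 0"
    proof (rule ccontr)
      assume nz: "(transpose V0 ** M ** U0)$2$2 \<noteq> 0"
      have "det (transpose V0 ** M ** U0) = det V0 * (M$1$1 * M$2$2) * det U0"
        by (simp only: det_mul det_transpose) (simp add: det_2 M21)
      also have "M$1$1 * M$2$2 = 0" using M that(2) by auto
      finally have "det (transpose V0 ** M ** U0) = 0" by simp
      moreover have "diagonal2 (transpose V0 ** M ** U0)" using 1(3) by (simp add: unnormalized_svd_def)
      ultimately have "(transpose V0 ** M ** U0)$1$1 = 0" using nz by (simp add: det_2 diagonal2_def)
      with 1(4)[OF that(1)] nz show False by simp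
    qed
    with True 1 near1 show thesis by (intro that[of U0 V0]) (auto simp: M_def)
  next
    case False
    with UV UV1 have nz: "C$1$1 \<noteq> 0" "B$2$2 \<noteq> 0" and UJ: "U = U1 ** J2" "V = V1 ** J2"
      by (auto simp: computed_UV_def M_def Let_def split: if_splits)
    have nearJ: "near (93/2 * \<epsilon>) (X ** J2) (X0 ** J2) (abs_mat (X0 ** J2))"
      if "near (93/2 * \<epsilon>) X X0 (abs_mat X0)" for X X0
      using that by (simp add: near_def close_def forall_2 matmul_nth abs_minus_commute)
    have diagJ: "diagonal2 (transpose J2 ** S ** J2)" if "diagonal2 S" for S
      using that by (simp add: diagonal2_def matmul_nth)
    have "transpose (V0 ** J2) ** M ** (U0 ** J2) = transpose J2 ** (transpose V0 ** M ** U0) ** J2"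
      by (simp only: matrix_transpose_mul matrix_mul_assoc)
    with 1(3) orthogonal_J2 have "unnormalized_svd M (U0 ** J2) (V0 ** J2)"
      by (simp only: unnormalized_svd_def orthogonal_matrix_mul diagJ simp_thms)
    with nz 1(1,2) nearJ[OF near1(1)] nearJ[OF near1(2)] show thesis
      by (intro that[of "U0 ** J2" "V0 ** J2"]) (auto simp: UJ M_def fl_mat_matmul_J2)
  qed
qed

text \<open>For the degenerate case, in which no ratio is available: the entry set to zero has exact
  value 0, so its size is bounded by its error. The constant 290 only serves to match the general
  bound.\<close>

lemma near_entry_le:
  assumes "near (58 * \<epsilon>) X X\<^sub>0 Y" "X\<^sub>0$r$s = 0" "norm (Y$r) \<le> N"
  shows "\<bar>X$r$s\<bar> \<le> 290 * \<epsilon> * N"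
proof -
  have "\<bar>X$r$s\<bar> \<le> 58 * \<epsilon> * Y$r$s" using closeD[OF near_close[OF assms(1)], of r s] assms(2) by simp
  also have "\<dots> \<le> 58 * \<epsilon> * N"
    using eps_pos assms(3) component_le_norm_cart[of "Y$r" s] by (intro mult_left_mono) auto
  also have "\<dots> \<le> 290 * \<epsilon> * N"
    using eps_pos order_trans[OF norm_ge_zero assms(3)] by (intro mult_right_mono) auto
  finally show ?thesis .
qed

text \<open>The relative error \<open>93/2 = 46.5\<close> of \<open>U\<close> and \<open>V\<close> increases by at most 3 with each product. Together
  with 5 for the error of \<open>M\<close>, the total is less than 58.\<close>

lemma near_products:
  assumes fl: "fl_mat fp A" "fl_mat fp B" "fl_mat fp C" "fl_mat fp U" "fl_mat fp V"
    and U: "near (93/2 * \<epsilon>) U U\<^sub>0 (abs_mat U\<^sub>0)" and V: "near (93/2 * \<epsilon>) V V\<^sub>0 (abs_mat V\<^sub>0)"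
  shows "near (99/2 * \<epsilon>) (fl_matmul fp (transpose V) C) (transpose V\<^sub>0 ** C) (transpose (abs_mat V\<^sub>0) ** abs_mat C)"
    and "near (99/2 * \<epsilon>) (fl_matmul fp B U) (B ** U\<^sub>0) (abs_mat B ** abs_mat U\<^sub>0)"
proof -
  have self: "near (0 * \<epsilon>) X X (abs_mat X)" for X using near_refl by simp
  show "near (99/2 * \<epsilon>) (fl_matmul fp (transpose V) C) (transpose V\<^sub>0 ** C) (transpose (abs_mat V\<^sub>0) ** abs_mat C)"
    using near_fl_matmul[OF near_transpose[OF V] self fl_mat_transpose[OF fl(5)] fl(3)] by simp
  show "near (99/2 * \<epsilon>) (fl_matmul fp B U) (B ** U\<^sub>0) (abs_mat B ** abs_mat U\<^sub>0)"
    using near_fl_matmul[OF self U fl(2,4)] by simp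
qed

lemma near_matmul_adj2:
  assumes A: "fl_mat fp A" and X: "fl_mat fp X" "near (99/2 * \<epsilon>) X X\<^sub>0 Y"
  shows "near (105/2 * \<epsilon>) (fl_matmul fp (adj2 A) X) (adj2 A ** X\<^sub>0) (abs_mat (adj2 A) ** Y)"
    and "near (105/2 * \<epsilon>) (fl_matmul fp X (adj2 A)) (X\<^sub>0 ** adj2 A) (Y ** abs_mat (adj2 A))"
proof -
  have self: "near (0 * \<epsilon>) (adj2 A) (adj2 A) (abs_mat (adj2 A))" using near_refl by simp
  show "near (105/2 * \<epsilon>) (fl_matmul fp (adj2 A) X) (adj2 A ** X\<^sub>0) (abs_mat (adj2 A) ** Y)"
    using near_fl_matmul[OF self X(2) fl_mat_adj2[OF A] X(1)] by simp
  show "near (105/2 * \<epsilon>) (fl_matmul fp X (adj2 A)) (X\<^sub>0 ** adj2 A) (Y ** abs_mat (adj2 A))"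
    using near_fl_matmul[OF X(2) self X(1) fl_mat_adj2[OF A]] by simp
qed

text \<open>A single row of |V|^T or column of |U| has norm 1, and the triangular factors keep their
  norms under absolute values. Hence no factor sqrt 2 enters.\<close>

lemma dominating_row_norms:
  assumes "upper_tri A" "upper_tri B" "upper_tri C" and orth: "orthogonal_matrix U" "orthogonal_matrix V"
  shows "norm ((transpose (abs_mat V) ** abs_mat C)$i) \<le> spec_norm C"
    and "norm (transpose (abs_mat B ** abs_mat U)$i) \<le> spec_norm B"
    and "norm ((transpose (abs_mat V) ** abs_mat C ** abs_mat (adj2 A))$i) \<le> spec_norm A * spec_norm C"
    and "norm (transpose (abs_mat (adj2 A) ** (abs_mat B ** abs_mat U))$i) \<le> spec_norm A * spec_norm B"
proof -
  have one: "norm (transpose (abs_mat W)$i) \<le> 1" if "orthogonal_matrix W" for W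
    using norm_orthogonal_row[of "transpose W" i] that by (simp flip: abs_mat_transpose)
  have "upper_tri (adj2 A)" using assms by (simp add: upper_tri_def)
  then have a: "spec_norm (abs_mat (adj2 A)) \<le> spec_norm A" using spec_norm_abs_mat_upper_tri by fastforce
  note b = spec_norm_abs_mat_upper_tri[OF assms(2)] and c = spec_norm_abs_mat_upper_tri[OF assms(3)]
  show C: "norm ((transpose (abs_mat V) ** abs_mat C)$i) \<le> spec_norm C"
    using norm_row_matmul_le_mult[OF one[OF orth(2)] c] by simp
  show B: "norm (transpose (abs_mat B ** abs_mat U)$i) \<le> spec_norm B"
    using norm_row_matmul_le_mult[OF one[OF orth(1)], of "transpose (abs_mat B)" "spec_norm B"] b
    by (simp add: matrix_transpose_mul)
  show "norm ((transpose (abs_mat V) ** abs_mat C ** abs_mat (adj2 A))$i) \<le> spec_norm A * spec_norm C"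
    using norm_row_matmul_le_mult[OF C a] by (simp add: mult.commute)
  show "norm (transpose (abs_mat (adj2 A) ** (abs_mat B ** abs_mat U))$i) \<le> spec_norm A * spec_norm B"
    using norm_row_matmul_le_mult[OF B, of "transpose (abs_mat (adj2 A))"] a
    by (simp add: matrix_transpose_mul[of "abs_mat (adj2 A)"] mult.commute)
qed

lemma stable_pair_exactI:
  assumes "lower_tri G'" "lower_tri H'" "orthogonal_matrix Q"
    "spec_norm (G' - G\<^sub>0 ** Q) \<le> 480 * \<epsilon> * N" "spec_norm (H' - transpose Q ** H\<^sub>0) \<le> 480 * \<epsilon> * N'"
    "0 \<le> N" "0 \<le> N'" "G'$2 \<bullet> transpose H' $ 1 = 0"
  shows "stable_pair G\<^sub>0 H\<^sub>0 N N' G' H'"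
proof -
  have "\<exists>e f. norm e \<le> 80 * \<epsilon> * N \<and> norm f \<le> 80 * \<epsilon> * N' \<and> (G'$2 + e) \<bullet> (transpose H' $ 1 + f) = 0"
    using assms(6-8) eps_pos by (intro exI[of _ 0]) simp
  with assms(1-5) show ?thesis unfolding stable_pair_def by blast
qed

section \<open>The two branches of the algorithm\<close>

lemma rsvd22_generic_stable:
  assumes fl: "fl_mat fp A" "fl_mat fp B" "fl_mat fp C"
    and tri: "upper_tri A" "upper_tri B" "upper_tri C" and "invertible A"
    and svd: "xlasv2_model \<epsilon> (zg \<or> zl) fp" and nondeg: "C$1$1 \<noteq> 0 \<or> B$2$2 \<noteq> 0"
    and res: "rsvd22_generic fp zg zl A B C =
         \<lparr> res_A = A', res_B = B', res_C = C', res_H = H, res_K = K,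
           res_P = P, res_Q = Q, res_U = U, res_V = V \<rparr>"
  obtains U\<^sub>0 V\<^sub>0 where "lower_tri A'" "unnormalized_svd (computed_M fp A B C) U\<^sub>0 V\<^sub>0"
    "within_of_diagonal (132 * \<epsilon> * spec_norm (computed_M fp A B C)) (transpose V ** computed_M fp A B C ** U)"
    "stable_pair (transpose V\<^sub>0 ** C) (adj2 A ** (B ** U\<^sub>0)) (spec_norm C) (spec_norm A * spec_norm B)
      C' (zero_entry 1 2 (fl_matmul fp (transpose Q) H))"
    "stable_pair (transpose V\<^sub>0 ** C ** adj2 A) (B ** U\<^sub>0) (spec_norm A * spec_norm C) (spec_norm B)
      (zero_entry 1 2 (fl_matmul fp K P)) B'"
proof -
  define M where "M = computed_M fp A B C"
  obtain U1 V1 where "computed_UV fp A B C = (U1, V1)" by fastforce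
  moreover from this res have "U1 = U" "V1 = V" by (auto simp: rsvd22_generic_def Let_def)
  ultimately have UV: "computed_UV fp A B C = (U, V)" by simp
  obtain U\<^sub>0 V\<^sub>0 where UV0: "fl_mat fp U" "fl_mat fp V" "unnormalized_svd M U\<^sub>0 V\<^sub>0"
    "near (93/2 * \<epsilon>) U U\<^sub>0 (abs_mat U\<^sub>0)" "near (93/2 * \<epsilon>) V V\<^sub>0 (abs_mat V\<^sub>0)"
    "(zg \<or> zl) \<and> (C$1$1 = 0 \<or> B$2$2 = 0) \<longrightarrow> (transpose V\<^sub>0 ** M ** U\<^sub>0)$2$2 = 0"
    unfolding M_def by (rule computed_UV_svd[OF fl tri svd UV])
  have orth: "orthogonal_matrix U\<^sub>0" "orthogonal_matrix V\<^sub>0"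
    and diag: "diagonal2 (transpose V\<^sub>0 ** M ** U\<^sub>0)"
    using UV0(3) by (auto simp: unnormalized_svd_def)
  have A_nz: "A$1$1 \<noteq> 0" "A$2$2 \<noteq> 0"
    using \<open>invertible A\<close> tri(1) by (auto simp: invertible_det_nz det_2 upper_tri_def)
  obtain C\<^sub>1 H\<^sub>1 K\<^sub>1 B\<^sub>1 where M1: "M = C\<^sub>1 ** H\<^sub>1" "M = K\<^sub>1 ** B\<^sub>1"
    "close (5 * \<epsilon>) C\<^sub>1 C (abs_mat C)" "close (5 * \<epsilon>) H\<^sub>1 (adj2 A ** B) (abs_mat (adj2 A) ** abs_mat B)"
    "close (5 * \<epsilon>) K\<^sub>1 (C ** adj2 A) (abs_mat C ** abs_mat (adj2 A))" "close (5 * \<epsilon>) B\<^sub>1 B (abs_mat B)"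
    "C\<^sub>1$1$1 = C$1$1" "C\<^sub>1$2$1 = 0" "H\<^sub>1$2$2 = A$1$1 * B$2$2"
    "B\<^sub>1$2$2 = B$2$2" "B\<^sub>1$2$1 = 0" "K\<^sub>1$1$1 = C$1$1 * A$2$2"
    unfolding M_def by (rule computed_M_factorization[OF fl tri])

  define X where "X = transpose (abs_mat V\<^sub>0) ** abs_mat C"
  define Y where "Y = abs_mat B ** abs_mat U\<^sub>0"
  define G0 where "G0 = fl_matmul fp (transpose V) C"
  define G where "G = (if zg \<and> C$1$1 = 0 then zero_entry 2 2 G0 else G0)"
  define L0 where "L0 = fl_matmul fp B U"
  define L where "L = (if zl \<and> B$2$2 = 0 then zero_entry 1 2 L0 else L0)"
  define Gh where "Gh = fl_matmul fp (transpose (abs_mat V)) (abs_mat C)"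
  define Lh where "Lh = fl_matmul fp (abs_mat B) (abs_mat U)"
  define Hh where "Hh = fl_matmul fp (abs_mat (adj2 A)) Lh"
  define Kh where "Kh = fl_matmul fp Gh (abs_mat (adj2 A))"
  define eta_g where "eta_g = fl_eta fp (Gh$1$1) (Gh$1$2) (G$1$1) (G$1$2)"
  define eta_h where "eta_h = fl_eta fp (Hh$1$2) (Hh$2$2) (H$1$2) (H$2$2)"
  define eta_k where "eta_k = fl_eta fp (Kh$1$1) (Kh$1$2) (K$1$1) (K$1$2)"
  define eta_l where "eta_l = fl_eta fp (Lh$1$2) (Lh$2$2) (L$1$2) (L$2$2)"
  note defs = G_def L_def G0_def L0_def Hh_def Kh_def Gh_def Lh_def
  note sel = arg_cong[where f = res_A, OF res, symmetric] arg_cong[where f = res_B, OF res, symmetric]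
    arg_cong[where f = res_C, OF res, symmetric] arg_cong[where f = res_H, OF res, symmetric]
    arg_cong[where f = res_K, OF res, symmetric] arg_cong[where f = res_P, OF res, symmetric]
    arg_cong[where f = res_Q, OF res, symmetric]
  note sel = sel[unfolded rsvd22_generic_def UV Let_def prod.case rsvd22_result.select_convs]
  have H: "H = fl_matmul fp (adj2 A) L" and K: "K = fl_matmul fp G (adj2 A)"
    unfolding defs by (rule sel)+
  have Q: "Q = (if fl_add fp \<bar>H$1$2\<bar> \<bar>H$2$2\<bar> = 0 \<or> (fl_add fp \<bar>G$1$1\<bar> \<bar>G$1$2\<bar> \<noteq> 0 \<and> eta_g \<le> eta_h)
      then rot_to_first fp (G$1$1) (G$1$2) else rot_to_second fp (H$1$2) (H$2$2))"
    unfolding eta_g_def eta_h_def H unfolding defs by (rule sel)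
  have P: "P = (if fl_add fp \<bar>K$1$1\<bar> \<bar>K$1$2\<bar> = 0 \<or> (fl_add fp \<bar>L$1$2\<bar> \<bar>L$2$2\<bar> \<noteq> 0 \<and> eta_l \<le> eta_k)
      then rot_to_second fp (L$1$2) (L$2$2) else rot_to_first fp (K$1$1) (K$1$2))"
    unfolding eta_k_def eta_l_def K unfolding defs by (rule sel)
  have res': "A' = zero_entry 1 2 (fl_matmul fp (fl_matmul fp (transpose P) A) Q)"
    "B' = zero_entry 1 2 (fl_matmul fp (transpose P) L)" "C' = zero_entry 1 2 (fl_matmul fp G Q)"
    unfolding P Q unfolding eta_g_def eta_h_def eta_k_def eta_l_def H K unfolding defs by (rule sel)+

  have flA: "fl_mat fp (abs_mat A)" "fl_mat fp (abs_mat B)" "fl_mat fp (abs_mat C)"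
    "fl_mat fp (abs_mat U)" "fl_mat fp (abs_mat V)"
    using fl UV0(1,2) by (auto intro: fl_mat_abs_mat)
  have fl': "fl_mat fp G" "fl_mat fp L" "fl_mat fp H" "fl_mat fp K"
    "fl_mat fp Gh" "fl_mat fp Lh" "fl_mat fp Hh" "fl_mat fp Kh"
    unfolding H K G_def L_def G0_def L0_def Gh_def Lh_def Hh_def Kh_def using fl flA UV0(1,2)
    by (auto intro!: fl_mat_matmul fl_mat_zero_entry fl_mat_transpose fl_mat_adj2 fl_mat_abs_mat)

  have close_G1: "close (5 * \<epsilon>) (transpose V\<^sub>0 ** C\<^sub>1) (transpose V\<^sub>0 ** C) X"
    using close_matmul_left[OF M1(3), of "transpose V\<^sub>0"] by (simp add: X_def abs_mat_transpose)
  have close_L1: "close (5 * \<epsilon>) (B\<^sub>1 ** U\<^sub>0) (B ** U\<^sub>0) Y"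
    using close_matmul_right[OF M1(6), of U\<^sub>0] by (simp add: Y_def)
  have close_K1: "close (5 * \<epsilon>) (transpose V\<^sub>0 ** K\<^sub>1) (transpose V\<^sub>0 ** C ** adj2 A) (X ** abs_mat (adj2 A))"
    using close_matmul_left[OF M1(5), of "transpose V\<^sub>0"]
    by (simp add: X_def abs_mat_transpose matrix_mul_assoc)
  have close_H1: "close (5 * \<epsilon>) (H\<^sub>1 ** U\<^sub>0) (adj2 A ** (B ** U\<^sub>0)) (abs_mat (adj2 A) ** Y)"
    using close_matmul_right[OF M1(4), of U\<^sub>0] by (simp add: Y_def matrix_mul_assoc)

  \<comment> \<open>If the second diagonal entry is zero, then the diagonal matrix has a zero second
    row and a zero second column, and so have the half-transformed products. This prepares the
    optional assignments.\<close>
  have V0M: "(transpose V\<^sub>0 ** M)$2$j = 0" and MU0: "(M ** U\<^sub>0)$i$2 = 0"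
    if "(transpose V\<^sub>0 ** M ** U\<^sub>0)$2$2 = 0" for i j
  proof -
    define S where "S = transpose V\<^sub>0 ** M ** U\<^sub>0"
    have S: "S$2$1 = 0" "S$2$2 = 0" "S$1$2 = 0" using diag that by (auto simp: diagonal2_def S_def)
    have "transpose V\<^sub>0 ** M = S ** transpose U\<^sub>0"
      using orth(1) by (simp add: S_def orthogonal_matrix_def flip: matrix_mul_assoc)
    with S show "(transpose V\<^sub>0 ** M)$2$j = 0" by (simp add: matmul_nth[of S])
    have "M ** U\<^sub>0 = V\<^sub>0 ** S"
      using orth(2) by (simp add: S_def orthogonal_matrix_def matrix_mul_assoc)
    with S show "(M ** U\<^sub>0)$i$2 = 0" by (simp add: matmul_nth[of _ S])
  qed

  have near_G: "near (99/2 * \<epsilon>) G (transpose V\<^sub>0 ** C) X"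
  proof (cases "zg \<and> C$1$1 = 0")
    case True
    then have "(transpose V\<^sub>0 ** M)$2$2 = 0" using UV0(6) V0M by simp
    \<comment> \<open>With \<open>c11 = 0\<close> the first column of \<open>C\<^sub>1\<close>
      vanishes, so only one term of the product remains. Its factor \<open>a11 * b22\<close> is
      nonzero, which forces the entry of the perturbed factor to be exactly 0; the assignment then
      changes \<open>G\<close> by no more than its error bound allows.\<close>
    moreover have "(transpose V\<^sub>0 ** M)$2$2 = (transpose V\<^sub>0 ** C\<^sub>1)$2$2 * (A$1$1 * B$2$2)"
      using True M1(7,8,9) unfolding M1(1) by (simp add: matmul_nth algebra_simps)
    ultimately have "(transpose V\<^sub>0 ** C\<^sub>1)$2$2 = 0" using A_nz nondeg True by simp
    with closeD[OF close_G1, of 2 2] have "\<bar>(transpose V\<^sub>0 ** C)$2$2\<bar> \<le> 5 * \<epsilon> * X$2$2" by simp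
    also have "\<dots> \<le> 99/2 * \<epsilon> * X$2$2"
      using eps_pos by (intro mult_right_mono) (auto simp: X_def matmul_nth)
    finally show ?thesis
      using True near_zero_entry near_products(1)[OF fl UV0(1,2,4,5)] by (simp add: G_def G0_def X_def)
  next
    case False
    then show ?thesis
      using near_products(1)[OF fl UV0(1,2,4,5)] by (auto simp: G_def G0_def X_def)
  qed
  have near_L: "near (99/2 * \<epsilon>) L (B ** U\<^sub>0) Y"
  proof (cases "zl \<and> B$2$2 = 0")
    case True
    then have "(M ** U\<^sub>0)$1$2 = 0" using UV0(6) MU0 by simp
    moreover have "(M ** U\<^sub>0)$1$2 = C$1$1 * A$2$2 * (B\<^sub>1 ** U\<^sub>0)$1$2"
      using True M1(10,11,12) unfolding M1(2) by (simp add: matmul_nth algebra_simps)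
    ultimately have "(B\<^sub>1 ** U\<^sub>0)$1$2 = 0" using A_nz nondeg True by simp
    with closeD[OF close_L1, of 1 2] have "\<bar>(B ** U\<^sub>0)$1$2\<bar> \<le> 5 * \<epsilon> * Y$1$2" by simp
    also have "\<dots> \<le> 99/2 * \<epsilon> * Y$1$2"
      using eps_pos by (intro mult_right_mono) (auto simp: Y_def matmul_nth)
    finally show ?thesis
      using True near_zero_entry near_products(2)[OF fl UV0(1,2,4,5)] by (simp add: L_def L0_def Y_def)
  next
    case False
    then show ?thesis
      using near_products(2)[OF fl UV0(1,2,4,5)] by (auto simp: L_def L0_def Y_def)
  qed
  have near_H: "near (105/2 * \<epsilon>) H (adj2 A ** (B ** U\<^sub>0)) (abs_mat (adj2 A) ** Y)"
    unfolding H by (rule near_matmul_adj2(1)[OF fl(1) fl'(2) near_L])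
  have near_K: "near (105/2 * \<epsilon>) K (transpose V\<^sub>0 ** C ** adj2 A) (X ** abs_mat (adj2 A))"
    unfolding K by (rule near_matmul_adj2(2)[OF fl(1) fl'(1) near_G])
  \<comment> \<open>The error 105/2 of \<open>H\<close> and \<open>K\<close> is rounded up to 53.
    The passage to the perturbed factor of \<open>M\<close> adds 5.\<close>
  have near58: "near (58 * \<epsilon>) Z Z\<^sub>0 W" "close (58 * \<epsilon>) Z Z\<^sub>1 W"
    if "near (a * \<epsilon>) Z Z\<^sub>0 W" "close (5 * \<epsilon>) Z\<^sub>1 Z\<^sub>0 W" "a \<le> 53" for a Z Z\<^sub>0 Z\<^sub>1 W
  proof -
    have a: "a * \<epsilon> \<le> 53 * \<epsilon>" using that(3) eps_pos by simp
    with that(1) eps_pos show "near (58 * \<epsilon>) Z Z\<^sub>0 W" by (auto intro: near_mono)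
    have "close (53 * \<epsilon>) Z Z\<^sub>0 W" using near_close[OF near_mono[OF that(1) a]] .
    from close_trans[OF this close_sym[OF that(2)]] show "close (58 * \<epsilon>) Z Z\<^sub>1 W"
      by (simp flip: distrib_right)
  qed

  have self: "near (0 * \<epsilon>) (abs_mat Z) (abs_mat Z) (abs_mat Z)" for Z
    using near_abs_mat[OF near_refl] by simp
  \<comment> \<open>The exact values of the hatted matrices, taken at the exact
    \<open>U\<^sub>0\<close> and \<open>V\<^sub>0\<close>, are the matrices that dominate the errors
    of \<open>G\<close>, \<open>L\<close>, \<open>K\<close> and \<open>H\<close>. The computed
    ratios can therefore be used in the selection hypothesis.\<close>
  have near_Gh: "near (99/2 * \<epsilon>) Gh X X"
    using near_fl_matmul[OF near_transpose[OF near_abs_mat[OF UV0(5)]] self fl_mat_transpose[OF flA(5)] flA(3)]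
    by (simp add: Gh_def X_def)
  have near_Lh: "near (99/2 * \<epsilon>) Lh Y Y"
    using near_fl_matmul[OF self near_abs_mat[OF UV0(4)] flA(2,4)] by (simp add: Lh_def Y_def)
  have near_Kh: "near (105/2 * \<epsilon>) Kh (X ** abs_mat (adj2 A)) (X ** abs_mat (adj2 A))"
    using near_fl_matmul[OF near_Gh self fl'(5) fl_mat_abs_mat[OF fl_mat_adj2[OF fl(1)]]]
    by (simp add: Kh_def)
  have near_Hh: "near (105/2 * \<epsilon>) Hh (abs_mat (adj2 A) ** Y) (abs_mat (adj2 A) ** Y)"
    using near_fl_matmul[OF self near_Lh fl_mat_abs_mat[OF fl_mat_adj2[OF fl(1)]] fl'(6)]
    by (simp add: Hh_def)
  have hat: "\<bar>Z$i$j - W$i$j\<bar> \<le> 60 * \<epsilon> * W$i$j" "0 \<le> W$i$j"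
    if "near (a * \<epsilon>) Z W W" "a \<le> 60" for a Z W i j
  proof -
    have "a * \<epsilon> \<le> 60 * \<epsilon>" using that eps_pos by simp
    from closeD[OF near_close[OF near_mono[OF that(1) this]]]
    show "\<bar>Z$i$j - W$i$j\<bar> \<le> 60 * \<epsilon> * W$i$j" .
    show "0 \<le> W$i$j" using near_nonneg[OF that(1)] .
  qed
  note hats = hat[OF near_Gh] hat[OF near_Lh] hat[OF near_Hh] hat[OF near_Kh]

  have ratio_Q: "eta_g \<le> eta_h \<Longrightarrow> (X$1$1 + X$1$2) * (\<bar>H$1$2\<bar> + \<bar>H$2$2\<bar>)
        \<le> 11/10 * ((abs_mat (adj2 A) ** Y)$1$2 + (abs_mat (adj2 A) ** Y)$2$2) * (\<bar>G$1$1\<bar> + \<bar>G$1$2\<bar>)"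
    "eta_h \<le> eta_g \<Longrightarrow> ((abs_mat (adj2 A) ** Y)$1$2 + (abs_mat (adj2 A) ** Y)$2$2) * (\<bar>G$1$1\<bar> + \<bar>G$1$2\<bar>)
        \<le> 11/10 * (X$1$1 + X$1$2) * (\<bar>H$1$2\<bar> + \<bar>H$2$2\<bar>)"
    unfolding eta_g_def eta_h_def
    by (rule fl_eta_leD; (rule fl_mat_nth fl' hats | assumption | simp)+)+
  have ratio_P: "eta_k \<le> eta_l \<Longrightarrow> ((X ** abs_mat (adj2 A))$1$1 + (X ** abs_mat (adj2 A))$1$2) * (\<bar>L$1$2\<bar> + \<bar>L$2$2\<bar>)
        \<le> 11/10 * (Y$1$2 + Y$2$2) * (\<bar>K$1$1\<bar> + \<bar>K$1$2\<bar>)"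
    "eta_l \<le> eta_k \<Longrightarrow> (Y$1$2 + Y$2$2) * (\<bar>K$1$1\<bar> + \<bar>K$1$2\<bar>)
        \<le> 11/10 * ((X ** abs_mat (adj2 A))$1$1 + (X ** abs_mat (adj2 A))$1$2) * (\<bar>L$1$2\<bar> + \<bar>L$2$2\<bar>)"
    unfolding eta_k_def eta_l_def
    by (rule fl_eta_leD; (rule fl_mat_nth fl' hats | assumption | simp)+)+

  have zero_iff: "fl_add fp \<bar>Z$i$j\<bar> \<bar>Z$k$l\<bar> = 0 \<longleftrightarrow> Z$i$j = 0 \<and> Z$k$l = 0" if "fl_mat fp Z" for Z i j k l
    by (rule fl_add_abs_eq_0_iff) (rule fl_mat_nth that)+

  have "stable_pair (transpose V\<^sub>0 ** C) (adj2 A ** (B ** U\<^sub>0)) (spec_norm C) (spec_norm A * spec_norm B)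
      (zero_entry 1 2 (fl_matmul fp G Q)) (zero_entry 1 2 (fl_matmul fp (transpose Q) H))"
  proof (rule stable_pairI)
    show "diagonal2 ((transpose V\<^sub>0 ** C\<^sub>1) ** (H\<^sub>1 ** U\<^sub>0))" using diag by (simp add: M1(1) matrix_mul_assoc)
    show "Q = rot_to_first fp (G$1$1) (G$1$2) \<and>
        (H$1$2 = 0 \<and> H$2$2 = 0 \<or> (G$1$1 \<noteq> 0 \<or> G$1$2 \<noteq> 0) \<and>
          (X$1$1 + X$1$2) * (\<bar>H$1$2\<bar> + \<bar>H$2$2\<bar>)
          \<le> 11/10 * ((abs_mat (adj2 A) ** Y)$1$2 + (abs_mat (adj2 A) ** Y)$2$2) * (\<bar>G$1$1\<bar> + \<bar>G$1$2\<bar>))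
      \<or> Q = rot_to_second fp (H$1$2) (H$2$2) \<and>
        (G$1$1 = 0 \<and> G$1$2 = 0 \<or> (H$1$2 \<noteq> 0 \<or> H$2$2 \<noteq> 0) \<and>
          ((abs_mat (adj2 A) ** Y)$1$2 + (abs_mat (adj2 A) ** Y)$2$2) * (\<bar>G$1$1\<bar> + \<bar>G$1$2\<bar>)
          \<le> 11/10 * (X$1$1 + X$1$2) * (\<bar>H$1$2\<bar> + \<bar>H$2$2\<bar>))"
      using Q ratio_Q linear[of eta_g eta_h] unfolding zero_iff[OF fl'(1)] zero_iff[OF fl'(3)]
      by meson
  qed (use dominating_row_norms[OF tri orth] near58[OF near_G close_G1] near58[OF near_H close_H1] fl'
      in \<open>simp_all add: X_def Y_def\<close>)
  \<comment> \<open>Here \<open>K\<close> takes the place of \<open>G\<close> and \<open>L\<close>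
    that of \<open>H\<close>; the test for \<open>P\<close> is mirrored accordingly.\<close>
  moreover have "stable_pair (transpose V\<^sub>0 ** C ** adj2 A) (B ** U\<^sub>0) (spec_norm A * spec_norm C) (spec_norm B)
      (zero_entry 1 2 (fl_matmul fp K P)) (zero_entry 1 2 (fl_matmul fp (transpose P) L))"
  proof (rule stable_pairI)
    show "diagonal2 ((transpose V\<^sub>0 ** K\<^sub>1) ** (B\<^sub>1 ** U\<^sub>0))" using diag by (simp add: M1(2) matrix_mul_assoc)
    show "P = rot_to_first fp (K$1$1) (K$1$2) \<and>
        (L$1$2 = 0 \<and> L$2$2 = 0 \<or> (K$1$1 \<noteq> 0 \<or> K$1$2 \<noteq> 0) \<and>
          ((X ** abs_mat (adj2 A))$1$1 + (X ** abs_mat (adj2 A))$1$2) * (\<bar>L$1$2\<bar> + \<bar>L$2$2\<bar>)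
          \<le> 11/10 * (Y$1$2 + Y$2$2) * (\<bar>K$1$1\<bar> + \<bar>K$1$2\<bar>))
      \<or> P = rot_to_second fp (L$1$2) (L$2$2) \<and>
        (K$1$1 = 0 \<and> K$1$2 = 0 \<or> (L$1$2 \<noteq> 0 \<or> L$2$2 \<noteq> 0) \<and>
          (Y$1$2 + Y$2$2) * (\<bar>K$1$1\<bar> + \<bar>K$1$2\<bar>)
          \<le> 11/10 * ((X ** abs_mat (adj2 A))$1$1 + (X ** abs_mat (adj2 A))$1$2) * (\<bar>L$1$2\<bar> + \<bar>L$2$2\<bar>))"
      using P ratio_P linear[of eta_k eta_l] unfolding zero_iff[OF fl'(2)] zero_iff[OF fl'(4)]
      by meson
  qed (use dominating_row_norms[OF tri orth] near58[OF near_K close_K1] near58[OF near_L close_L1] fl'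
      in \<open>simp_all add: X_def Y_def\<close>)
  ultimately show thesis
    using within_of_diagonal_svd[OF UV0(3,4,5)] UV0(3)
    by (intro that[of U\<^sub>0 V\<^sub>0]) (auto simp: res' M_def lower_tri_def zero_entry_nth)
qed

text \<open>The first column of \<open>C\<close> and the second row of \<open>B\<close> vanish, so
  the computed \<open>M\<close> is exactly zero and any two orthogonal matrices form an SVD of it.
  The exact versions of the two computed rotations are chosen, so that the entries set to zero have
  exact value 0.\<close>

lemma rsvd22_degenerate_stable:
  assumes fl: "fl_mat fp A" "fl_mat fp B" "fl_mat fp C"
    and tri: "upper_tri A" "upper_tri B" "upper_tri C"
    and deg: "C$1$1 = 0" "B$2$2 = 0"
    and res: "rsvd22_degenerate fp A B C =
         \<lparr> res_A = A', res_B = B', res_C = C', res_H = H, res_K = K,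
           res_P = P, res_Q = Q, res_U = U, res_V = V \<rparr>"
  obtains U\<^sub>0 V\<^sub>0 where "lower_tri A'" "unnormalized_svd (computed_M fp A B C) U\<^sub>0 V\<^sub>0"
    "within_of_diagonal (132 * \<epsilon> * spec_norm (computed_M fp A B C)) (transpose V ** computed_M fp A B C ** U)"
    "stable_pair (transpose V\<^sub>0 ** C) (adj2 A ** (B ** U\<^sub>0)) (spec_norm C) (spec_norm A * spec_norm B)
      C' (zero_entry 1 2 (fl_matmul fp (transpose Q) H))"
    "stable_pair (transpose V\<^sub>0 ** C ** adj2 A) (B ** U\<^sub>0) (spec_norm A * spec_norm C) (spec_norm B)
      (zero_entry 1 2 (fl_matmul fp K P)) B'"
proof -
  define G where "G = fl_matmul fp (transpose V) C"
  define L where "L = fl_matmul fp B U"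
  have UV: "V = rot_to_first fp (C$1$2) (C$2$2)" "U = rot_to_second fp (B$1$1) (B$1$2)"
    using res by (simp_all add: rsvd22_degenerate_def Let_def)
  have res': "A' = transpose J2 ** A ** J2" "B' = zero_entry 2 1 (transpose J2 ** L)"
    "C' = zero_entry 2 1 (G ** J2)" "H = fl_matmul fp (adj2 A) L" "K = fl_matmul fp G (adj2 A)"
    "P = J2" "Q = J2"
    using res by (auto simp: rsvd22_degenerate_def Let_def G_def L_def)
  have z: "A$2$1 = 0" "B$2$1 = 0" "C$2$1 = 0" using tri by (auto simp: upper_tri_def)
  obtain V\<^sub>0 where V: "fl_mat fp V" "orthogonal_matrix V\<^sub>0" "near (6 * \<epsilon>) V V\<^sub>0 (abs_mat V\<^sub>0)"
    "C$1$2 * V\<^sub>0$1$2 + C$2$2 * V\<^sub>0$2$2 = 0"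
    unfolding UV using rot_to_first_near[OF fl_mat_nth[OF fl(3)] fl_mat_nth[OF fl(3)]] by metis
  obtain U\<^sub>0 where U: "fl_mat fp U" "orthogonal_matrix U\<^sub>0" "near (6 * \<epsilon>) U U\<^sub>0 (abs_mat U\<^sub>0)"
    "B$1$1 * U\<^sub>0$1$1 + B$1$2 * U\<^sub>0$2$1 = 0"
    unfolding UV using rot_to_second_near[OF fl_mat_nth[OF fl(2)] fl_mat_nth[OF fl(2)]] by metis
  have M: "computed_M fp A B C = 0"
    by (rule computed_M_entries[OF fl]) (simp add: deg rmat2_eq_iff)
  have flG: "fl_mat fp G" "fl_mat fp L" "fl_mat fp H" "fl_mat fp K"
    unfolding res' G_def L_def using fl U(1) V(1)
    by (auto intro!: fl_mat_matmul fl_mat_transpose fl_mat_adj2)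
  have UV': "near (93/2 * \<epsilon>) U U\<^sub>0 (abs_mat U\<^sub>0)" "near (93/2 * \<epsilon>) V V\<^sub>0 (abs_mat V\<^sub>0)"
    using near_mono[OF U(3)] near_mono[OF V(3)] eps_pos by auto
  note GL = near_products[OF fl U(1) V(1) UV', folded G_def L_def]
  have mono: "near (58 * \<epsilon>) Z Z\<^sub>0 W" if "near (a * \<epsilon>) Z Z\<^sub>0 W" "a \<le> 58" for a Z Z\<^sub>0 W
    using near_mono[OF that(1)] that(2) eps_pos by simp
  have near58: "near (58 * \<epsilon>) G (transpose V\<^sub>0 ** C) (transpose (abs_mat V\<^sub>0) ** abs_mat C)"
    "near (58 * \<epsilon>) L (B ** U\<^sub>0) (abs_mat B ** abs_mat U\<^sub>0)"
    "near (58 * \<epsilon>) H (adj2 A ** (B ** U\<^sub>0)) (abs_mat (adj2 A) ** (abs_mat B ** abs_mat U\<^sub>0))"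
    "near (58 * \<epsilon>) K (transpose V\<^sub>0 ** C ** adj2 A) (transpose (abs_mat V\<^sub>0) ** abs_mat C ** abs_mat (adj2 A))"
    using mono[OF GL(1)] mono[OF GL(2)] mono[OF near_matmul_adj2(1)[OF fl(1) flG(2) GL(2)]]
      mono[OF near_matmul_adj2(2)[OF fl(1) flG(1) GL(1)]] by (simp_all add: res')
  note nearL' = near_transpose[OF near58(2)] and nearH' = near_transpose[OF near58(3)]
  note N = dominating_row_norms[OF tri U(2) V(2)]
  \<comment> \<open>\<open>J2\<close> stands for both the computed and the exact rotation.
    Multiplication by it is without error, so the general bounds for rotated matrices apply.\<close>
  have J: "near (6 * \<epsilon>) J2 J2 (abs_mat J2)" using near_mono[OF near_refl] eps_pos by simp
  have exact: "close (5/2 * \<epsilon>) (Z ** J2) (Z ** J2) (abs_mat Z ** abs_mat J2)" for Z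
    using eps_pos by (simp add: close_def matmul_nth)

  have "spec_norm (C' - transpose V\<^sub>0 ** C ** J2) \<le> 480 * \<epsilon> * spec_norm C"
    unfolding res' using near_entry_le[OF near58(1) _ N(1), of 2 2] V(4)
    by (intro rotated_zero_entry_bound[OF orthogonal_J2 J exact near58(1) N(1)])
      (simp add: matmul_nth mult.commute)
  moreover have "spec_norm (B' - transpose J2 ** (B ** U\<^sub>0)) \<le> 480 * \<epsilon> * spec_norm B"
  proof -
    have "spec_norm (zero_entry 1 2 (transpose L ** J2) - transpose (B ** U\<^sub>0) ** J2) \<le> 480 * \<epsilon> * spec_norm B"
      using near_entry_le[OF nearL' _ N(2), of 1 1] U(4)
      by (intro rotated_zero_entry_bound[OF orthogonal_J2 J exact nearL' N(2)]) (simp add: matmul_nth)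
    also have "zero_entry 1 2 (transpose L ** J2) - transpose (B ** U\<^sub>0) ** J2 = transpose (B' - transpose J2 ** (B ** U\<^sub>0))"
      by (simp only: res' transpose_zero_entry transpose_diff matrix_transpose_mul transpose_transpose)
    finally show ?thesis by simp
  qed
  moreover have "spec_norm (zero_entry 1 2 (fl_matmul fp K P) - transpose V\<^sub>0 ** C ** adj2 A ** J2)
      \<le> 480 * \<epsilon> * (spec_norm A * spec_norm C)"
    unfolding res'(6) using near_entry_le[OF near58(4) _ N(3), of 1 1]
    by (intro rotated_zero_entry_bound[OF orthogonal_J2 J fl_matmul_close[OF flG(4) fl_mat_J2] near58(4) N(3)])
      (simp add: matmul_nth deg z)
  moreover have "spec_norm (zero_entry 1 2 (fl_matmul fp (transpose Q) H) - transpose J2 ** (adj2 A ** (B ** U\<^sub>0)))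
      \<le> 480 * \<epsilon> * (spec_norm A * spec_norm B)"
  proof -
    have "spec_norm (zero_entry 2 1 (transpose (fl_matmul fp (transpose J2) H)) - transpose (adj2 A ** (B ** U\<^sub>0)) ** J2)
        \<le> 480 * \<epsilon> * (spec_norm A * spec_norm B)"
      using near_entry_le[OF nearH' _ N(4), of 2 2]
      by (intro rotated_zero_entry_bound[OF orthogonal_J2 J
            fl_matmul_transpose_close[OF fl_mat_J2 flG(3)] nearH' N(4)])
        (simp add: matmul_nth deg z)
    also have "zero_entry 2 1 (transpose (fl_matmul fp (transpose J2) H)) - transpose (adj2 A ** (B ** U\<^sub>0)) ** J2
        = transpose (zero_entry 1 2 (fl_matmul fp (transpose Q) H) - transpose J2 ** (adj2 A ** (B ** U\<^sub>0)))"
      by (simp only: res'(7) transpose_zero_entry transpose_diff matrix_transpose_mul transpose_transpose)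
    finally show ?thesis by simp
  qed
  \<comment> \<open>These zeros are exact also in floating point. After the swap and the assignment,
    the second row of C' and the first column of B' vanish, and the orthogonality holds without any
    perturbation.\<close>
  moreover have "G$i$1 = 0" "L$2$j = 0" for i j
    using fl_mat_nth[OF V(1)] fl_mat_nth[OF U(1)]
    by (simp_all add: G_def L_def fl_matmul_def deg z fl_mul_zero fl_add_zero)
  then have "C'$1$2 = 0" "B'$1$2 = 0" "C'$2 = 0" "transpose B' $ 1 = 0"
    by (simp_all add: res' zero_entry_nth matmul_nth vec_eq_iff forall_2)
  moreover have "lower_tri (zero_entry 1 2 Z)" for Z by (simp add: lower_tri_def zero_entry_nth)
  ultimately have
    "stable_pair (transpose V\<^sub>0 ** C) (adj2 A ** (B ** U\<^sub>0)) (spec_norm C) (spec_norm A * spec_norm B)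
      C' (zero_entry 1 2 (fl_matmul fp (transpose Q) H))"
    "stable_pair (transpose V\<^sub>0 ** C ** adj2 A) (B ** U\<^sub>0) (spec_norm A * spec_norm C) (spec_norm B)
      (zero_entry 1 2 (fl_matmul fp K P)) B'"
    by (intro stable_pair_exactI[OF _ _ orthogonal_J2]; simp add: lower_tri_def)+
  moreover have "unnormalized_svd (computed_M fp A B C) U\<^sub>0 V\<^sub>0"
    using U(2) V(2) by (simp add: M unnormalized_svd_def diagonal2_def matmul_nth)
  moreover from within_of_diagonal_svd[OF this UV']
  have "within_of_diagonal (132 * \<epsilon> * spec_norm (computed_M fp A B C)) (transpose V ** computed_M fp A B C ** U)" .
  moreover have "lower_tri A'" by (simp add: res' lower_tri_def matmul_nth z)
  ultimately show thesis using that by blast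
qed

text \<open>The constant 80 serves all four matrices in the parallelism, below 86 and 93.5, and 480
  serves all four backward errors, below 486 and 493.\<close>

lemma rsvd22_stable:
  assumes fl: "fl_mat fp A" "fl_mat fp B" "fl_mat fp C"
    and tri: "upper_tri A" "upper_tri B" "upper_tri C" and inv: "invertible A"
    and svd: "xlasv2_model \<epsilon> (zg \<or> zl) fp" and M: "M = computed_M fp A B C"
    and res: "rsvd22 fp zg zl A B C =
         \<lparr> res_A = A', res_B = B', res_C = C', res_H = H, res_K = K,
           res_P = P, res_Q = Q, res_U = U, res_V = V \<rparr>"
    and H': "H' = zero_entry 1 2 (fl_matmul fp (transpose Q) H)"
    and K': "K' = zero_entry 1 2 (fl_matmul fp K P)"
  shows "(lower_tri A' \<and> lower_tri B' \<and> lower_tri C') \<and>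
    within_of_diagonal (132 * \<epsilon> * spec_norm M) (transpose V ** M ** U) \<and>
    (rows_within_of_parallel (86 * \<epsilon> * spec_norm C)
       (93.5 * \<epsilon> * spec_norm A * spec_norm B) C' (adj2 H') \<and>
     columns_within_of_parallel (93.5 * \<epsilon> * spec_norm A * spec_norm C)
       (86 * \<epsilon> * spec_norm B) (adj2 K') B') \<and>
    (\<exists>\<delta>B \<delta>C \<delta>H \<delta>K P\<^sub>o Q\<^sub>o U\<^sub>o V\<^sub>o.
       orthogonal_matrix P\<^sub>o \<and> orthogonal_matrix Q\<^sub>o \<and> unnormalized_svd M U\<^sub>o V\<^sub>o \<and>
       B' = transpose P\<^sub>o ** (B + \<delta>B) ** U\<^sub>o \<and>
       H' = transpose Q\<^sub>o ** (adj2 A ** B + \<delta>H) ** U\<^sub>o \<and>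
       C' = transpose V\<^sub>o ** (C + \<delta>C) ** Q\<^sub>o \<and>
       K' = transpose V\<^sub>o ** (C ** adj2 A + \<delta>K) ** P\<^sub>o \<and>
       spec_norm \<delta>B \<le> 493 * \<epsilon> * spec_norm B \<and>
       spec_norm \<delta>C \<le> 493 * \<epsilon> * spec_norm C \<and>
       spec_norm \<delta>H \<le> 486 * \<epsilon> * spec_norm A * spec_norm B \<and>
       spec_norm \<delta>K \<le> 486 * \<epsilon> * spec_norm A * spec_norm C)"
proof -
  obtain U\<^sub>0 V\<^sub>0 where A': "lower_tri A'" and svd0: "unnormalized_svd M U\<^sub>0 V\<^sub>0"
    and diag: "within_of_diagonal (132 * \<epsilon> * spec_norm M) (transpose V ** M ** U)"
    and GH: "stable_pair (transpose V\<^sub>0 ** C) (adj2 A ** (B ** U\<^sub>0)) (spec_norm C) (spec_norm A * spec_norm B) C' H'"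
    and KL: "stable_pair (transpose V\<^sub>0 ** C ** adj2 A) (B ** U\<^sub>0) (spec_norm A * spec_norm C) (spec_norm B) K' B'"
  proof (cases "C$1$1 = 0 \<and> B$2$2 = 0")
    case True
    then have deg: "C$1$1 = 0" "B$2$2 = 0" by simp_all
    from res have "rsvd22_degenerate fp A B C = \<lparr> res_A = A', res_B = B', res_C = C', res_H = H,
        res_K = K, res_P = P, res_Q = Q, res_U = U, res_V = V \<rparr>"
      by (simp only: rsvd22_def deg simp_thms if_True)
    from rsvd22_degenerate_stable[OF fl tri deg this] show thesis
      using that unfolding M H' K' by blast
  next
    case False
    then have nondeg: "C$1$1 \<noteq> 0 \<or> B$2$2 \<noteq> 0" by simp
    from res False have "rsvd22_generic fp zg zl A B C = \<lparr> res_A = A', res_B = B', res_C = C', res_H = H,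
        res_K = K, res_P = P, res_Q = Q, res_U = U, res_V = V \<rparr>"
      by (simp only: rsvd22_def if_False)
    from rsvd22_generic_stable[OF fl tri inv svd nondeg this] show thesis
      using that unfolding M H' K' by blast
  qed
  have orth: "orthogonal_matrix U\<^sub>0" "orthogonal_matrix V\<^sub>0" using svd0 by (auto simp: unnormalized_svd_def)
  have scale: "a * \<epsilon> * n \<le> b * \<epsilon> * n" if "a \<le> b" "0 \<le> n" for a b n :: real
    using that eps_pos by (intro mult_right_mono) auto
  obtain Q\<^sub>0 where Q\<^sub>0: "orthogonal_matrix Q\<^sub>0"
    "spec_norm (C' - transpose V\<^sub>0 ** C ** Q\<^sub>0) \<le> 480 * \<epsilon> * spec_norm C"
    "spec_norm (H' - transpose Q\<^sub>0 ** (adj2 A ** B) ** U\<^sub>0) \<le> 480 * \<epsilon> * (spec_norm A * spec_norm B)"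
    using GH by (auto simp: stable_pair_def matrix_mul_assoc)
  obtain P\<^sub>0 where P\<^sub>0: "orthogonal_matrix P\<^sub>0"
    "spec_norm (K' - transpose V\<^sub>0 ** (C ** adj2 A) ** P\<^sub>0) \<le> 480 * \<epsilon> * (spec_norm A * spec_norm C)"
    "spec_norm (B' - transpose P\<^sub>0 ** B ** U\<^sub>0) \<le> 480 * \<epsilon> * spec_norm B"
    using KL by (auto simp: stable_pair_def matrix_mul_assoc)
  obtain \<delta>C where C: "C' = transpose V\<^sub>0 ** (C + \<delta>C) ** Q\<^sub>0" "spec_norm \<delta>C \<le> 480 * \<epsilon> * spec_norm C"
    by (rule orthogonal_perturbation[OF orth(2) Q\<^sub>0(1,2)])
  obtain \<delta>H where H: "H' = transpose Q\<^sub>0 ** (adj2 A ** B + \<delta>H) ** U\<^sub>0"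
    "spec_norm \<delta>H \<le> 480 * \<epsilon> * (spec_norm A * spec_norm B)"
    by (rule orthogonal_perturbation[OF Q\<^sub>0(1) orth(1) Q\<^sub>0(3)])
  obtain \<delta>K where K: "K' = transpose V\<^sub>0 ** (C ** adj2 A + \<delta>K) ** P\<^sub>0"
    "spec_norm \<delta>K \<le> 480 * \<epsilon> * (spec_norm A * spec_norm C)"
    by (rule orthogonal_perturbation[OF orth(2) P\<^sub>0(1,2)])
  obtain \<delta>B where B: "B' = transpose P\<^sub>0 ** (B + \<delta>B) ** U\<^sub>0" "spec_norm \<delta>B \<le> 480 * \<epsilon> * spec_norm B"
    by (rule orthogonal_perturbation[OF P\<^sub>0(1) orth(1) P\<^sub>0(3)])
  have norms: "0 \<le> spec_norm A * spec_norm B" "0 \<le> spec_norm A * spec_norm C" by simp_all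
  have "lower_tri B'" "lower_tri C'" using GH KL by (simp_all add: stable_pair_def)
  moreover have "rows_within_of_parallel (86 * \<epsilon> * spec_norm C)
      (93.5 * \<epsilon> * (spec_norm A * spec_norm B)) C' (adj2 H')"
    by (rule stable_pair_rows[OF GH]) (intro scale norms spec_norm_nonneg; simp)+
  moreover have "columns_within_of_parallel (93.5 * \<epsilon> * (spec_norm A * spec_norm C))
      (86 * \<epsilon> * spec_norm B) (adj2 K') B'"
    by (rule stable_pair_columns[OF KL]) (intro scale norms spec_norm_nonneg; simp)+
  moreover have "\<exists>\<delta>B \<delta>C \<delta>H \<delta>K P\<^sub>o Q\<^sub>o U\<^sub>o V\<^sub>o.
       orthogonal_matrix P\<^sub>o \<and> orthogonal_matrix Q\<^sub>o \<and> unnormalized_svd M U\<^sub>o V\<^sub>o \<and>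
       B' = transpose P\<^sub>o ** (B + \<delta>B) ** U\<^sub>o \<and>
       H' = transpose Q\<^sub>o ** (adj2 A ** B + \<delta>H) ** U\<^sub>o \<and>
       C' = transpose V\<^sub>o ** (C + \<delta>C) ** Q\<^sub>o \<and>
       K' = transpose V\<^sub>o ** (C ** adj2 A + \<delta>K) ** P\<^sub>o \<and>
       spec_norm \<delta>B \<le> 493 * \<epsilon> * spec_norm B \<and> spec_norm \<delta>C \<le> 493 * \<epsilon> * spec_norm C \<and>
       spec_norm \<delta>H \<le> 486 * \<epsilon> * (spec_norm A * spec_norm B) \<and>
       spec_norm \<delta>K \<le> 486 * \<epsilon> * (spec_norm A * spec_norm C)"
  proof (intro exI conjI)
    show "spec_norm \<delta>B \<le> 493 * \<epsilon> * spec_norm B" "spec_norm \<delta>C \<le> 493 * \<epsilon> * spec_norm C"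
      by (rule order_trans[OF B(2)] order_trans[OF C(2)], rule scale; simp)+
    show "spec_norm \<delta>H \<le> 486 * \<epsilon> * (spec_norm A * spec_norm B)"
      "spec_norm \<delta>K \<le> 486 * \<epsilon> * (spec_norm A * spec_norm C)"
      by (rule order_trans[OF H(2)] order_trans[OF K(2)], rule scale; simp)+
  qed (fact Q\<^sub>0(1) P\<^sub>0(1) svd0 B(1) H(1) C(1) K(1))+
  ultimately show ?thesis using A' diag by (simp add: mult.assoc)
qed

end

theorem mainTheorem2:
  shows "\<exists>\<kappa> \<epsilon>\<^sub>0 :: real. 0 \<le> \<kappa> \<and> 0 < \<epsilon>\<^sub>0 \<and>
    (\<forall>(\<epsilon> :: real) (fp :: fp_env) zg zl A B C M A' B' C' H K P Q U V H' K'.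
       0 < \<epsilon> \<and> \<epsilon> \<le> \<epsilon>\<^sub>0 \<and>
       fl_ops_model \<epsilon> fp \<and> xlasv2_model \<epsilon> (zg \<or> zl) fp \<and> xlartg_model \<epsilon> fp \<and>
       fl_mat fp A \<and> fl_mat fp B \<and> fl_mat fp C \<and>
       upper_tri A \<and> upper_tri B \<and> upper_tri C \<and> invertible A \<and>
       M = computed_M fp A B C \<and>
       rsvd22 fp zg zl A B C =
         \<lparr> res_A = A', res_B = B', res_C = C', res_H = H, res_K = K,
           res_P = P, res_Q = Q, res_U = U, res_V = V \<rparr> \<and>
       H' = zero_entry 1 2 (fl_matmul fp (transpose Q) H) \<and>
       K' = zero_entry 1 2 (fl_matmul fp K P)
       \<longrightarrow>
       (lower_tri A' \<and> lower_tri B' \<and> lower_tri C') \<and>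
       within_of_diagonal ((132 * \<epsilon> + \<kappa> * \<epsilon>\<^sup>2) * spec_norm M) (transpose V ** M ** U) \<and>
       (rows_within_of_parallel
          ((86 * \<epsilon> + \<kappa> * \<epsilon>\<^sup>2) * spec_norm C)
          ((93.5 * \<epsilon> + \<kappa> * \<epsilon>\<^sup>2) * spec_norm A * spec_norm B)
          C' (adj2 H') \<and>
        columns_within_of_parallel
          ((93.5 * \<epsilon> + \<kappa> * \<epsilon>\<^sup>2) * spec_norm A * spec_norm C)
          ((86 * \<epsilon> + \<kappa> * \<epsilon>\<^sup>2) * spec_norm B)
          (adj2 K') B') \<and>
       (\<exists>\<delta>B \<delta>C \<delta>H \<delta>K P\<^sub>o Q\<^sub>o U\<^sub>o V\<^sub>o.
          orthogonal_matrix P\<^sub>o \<and> orthogonal_matrix Q\<^sub>o \<and> unnormalized_svd M U\<^sub>o V\<^sub>o \<and>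
          B' = transpose P\<^sub>o ** (B + \<delta>B) ** U\<^sub>o \<and>
          H' = transpose Q\<^sub>o ** (adj2 A ** B + \<delta>H) ** U\<^sub>o \<and>
          C' = transpose V\<^sub>o ** (C + \<delta>C) ** Q\<^sub>o \<and>
          K' = transpose V\<^sub>o ** (C ** adj2 A + \<delta>K) ** P\<^sub>o \<and>
          spec_norm \<delta>B \<le> (493 * \<epsilon> + \<kappa> * \<epsilon>\<^sup>2) * spec_norm B \<and>
          spec_norm \<delta>C \<le> (493 * \<epsilon> + \<kappa> * \<epsilon>\<^sup>2) * spec_norm C \<and>
          spec_norm \<delta>H \<le> (486 * \<epsilon> + \<kappa> * \<epsilon>\<^sup>2) * spec_norm A * spec_norm B \<and>
          spec_norm \<delta>K \<le> (486 * \<epsilon> + \<kappa> * \<epsilon>\<^sup>2) * spec_norm A * spec_norm C))"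
proof (rule exI[of _ 0], rule exI[of _ "1 / 10^6"], unfold mult_zero_left add_0_right,
    rule conjI[OF order_refl], rule conjI)
  show "(0::real) < 1 / 10^6" by simp
qed (intro allI impI, elim conjE, rule fp_model.rsvd22_stable, rule fp_model.intro, assumption+)

end
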